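(* Every subgroup $\Delta$ of finite index $n$ in $\pi_1(\mathcal{G}_6)$ is isomorphic to either $\pi_1(\mathcal{G}_6)$, or $\pi_1(\mathcal{G}_2)$, or $\mathbb{Z}^3=\pi_1(\mathcal{G}_1)$. For every positive integer $n$ the respective numbers of subgroups are (i) $s_{\mathcal{G}_1,\mathcal{G}_6}(n)=\omega\left(\frac{n}{4}\right)$, (ii) $s_{\mathcal{G}_2,\mathcal{G}_6}(n)=3\omega\left(\frac{n}{2}\right)-3\omega\left(\frac{n}{4}\right)$, (iii) $s_{\mathcal{G}_6,\mathcal{G}_6}(n)=n\left(d_3(n)-3d_3\left(\frac{n}{2}\right)+3d_3\left(\frac{n}{4}\right)-d_3\left(\frac{n}{8}\right)\right)$.
   Context: The groups are given by presentations (with $u^v$ denoting $vuv^{-1}$): $\pi_1(\mathcal{G}_1)=\mathbb{Z}^3$; $\pi_1(\mathcal{G}_2)=\langle x,y,z : xyx^{-1}y^{-1}=1,\ x^z=x^{-1},\ y^z=y^{-1}\rangle$; $\pi_1(\mathcal{G}_6)=\langle x,y,z : xy^2x^{-1}y^2=yx^2y^{-1}x^2=xyz=1\rangle$. $s_{\mathcal{G}_i,\mathcal{G}_6}(n)$ denotes the number of subgroups of index $n$ in $\pi_1(\mathcal{G}_6)$ that are isomorphic to $\pi_1(\mathcal{G}_i)$. Number-theoretic functions: for a positive integer $n$, $\omega(n)=\sum_{abc=n}a^2b$ and $d_3(n)=\sum_{abc=n}1$, the sums being over all ordered triples of positive integers $(a,b,c)$ with $abc=n$. By convention these functions take the value $0$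 when the argument is not an integer. *)

theory Defs
  imports Complex_Main "HOL-Algebra.Algebra"
begin

(* A letter (g, True) is the generator g, and (g, False) is its inverse. *)
type_synonym 'g word = "('g \<times> bool) list"

definition word_inv :: "'g word \<Rightarrow> 'g word" where
  "word_inv w = rev (map (\<lambda>(g, b). (g, \<not> b)) w)"

definition word_conj :: "'g word \<Rightarrow> 'g word \<Rightarrow> 'g word" where
  "word_conj u v = v @ u @ word_inv v"

(* The generating set of a presentation is the whole type 'g; a relation l = r is the pair (l, r). *)
inductive pres_eq :: "('g word \<times> 'g word) set \<Rightarrow> 'g word \<Rightarrow> 'g word \<Rightarrow> bool"
  for R where
  refl: "pres_eq R w w"
| sym: "pres_eq R u v \<Longrightarrow> pres_eq R v u"
| trans: "pres_eq R u v \<Longrightarrow> pres_eq R v w \<Longrightarrow> pres_eq R u w"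
| cancel: "pres_eq R (u @ [(g, b), (g, \<not> b)] @ v) (u @ v)"
| rel: "(l, r) \<in> R \<Longrightarrow> pres_eq R (u @ l @ v) (u @ r @ v)"

definition pres_class :: "('g word \<times> 'g word) set \<Rightarrow> 'g word \<Rightarrow> 'g word set" where
  "pres_class R w = {v. pres_eq R w v}"

definition presented_group :: "('g word \<times> 'g word) set \<Rightarrow> 'g word set monoid" where
  "presented_group R =
    \<lparr>carrier = range (pres_class R),
     monoid.mult = (\<lambda>A B. \<Union>u\<in>A. \<Union>v\<in>B. pres_class R (u @ v)),
     one = pres_class R []\<rparr>"

lemma pres_class_eq_iff: "pres_class R u = pres_class R v \<longleftrightarrow> pres_eq R u v"
  unfolding pres_class_def set_eq_iff mem_Collect_eq
  by (meson pres_eq.refl pres_eq.sym pres_eq.trans)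

lemma pres_eq_append_left: "pres_eq R u v \<Longrightarrow> pres_eq R (p @ u) (p @ v)"
proof (induction rule: pres_eq.induct)
  case (cancel u g b v)
  show ?case using pres_eq.cancel[of R "p @ u" g b v] by simp
next
  case (rel l r u v)
  then show ?case using pres_eq.rel[of l r R "p @ u" v] by simp
qed (auto intro: pres_eq.intros)

lemma pres_eq_append_right: "pres_eq R u v \<Longrightarrow> pres_eq R (u @ q) (v @ q)"
proof (induction rule: pres_eq.induct)
  case (cancel u g b v)
  show ?case using pres_eq.cancel[of R u g b "v @ q"] by simp
next
  case (rel l r u v)
  then show ?case using pres_eq.rel[of l r R u "v @ q"] by simp
next
  case (trans u v w)
  show ?case by (rule pres_eq.trans[OF trans.IH])
qed (rule pres_eq.refl pres_eq.sym, assumption?)+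

lemma pres_eq_append:
  assumes "pres_eq R u u'" and "pres_eq R v v'"
  shows "pres_eq R (u @ v) (u' @ v')"
  using pres_eq.trans[OF pres_eq_append_right[OF assms(1)] pres_eq_append_left[OF assms(2)]] .

lemma presented_group_mult:
  "pres_class R u \<otimes>\<^bsub>presented_group R\<^esub> pres_class R v = pres_class R (u @ v)"
proof -
  have "pres_class R (u' @ v') = pres_class R (u @ v)"
    if "u' \<in> pres_class R u" and "v' \<in> pres_class R v" for u' v'
    using that pres_eq_append[of R u u' v v']
    unfolding pres_class_eq_iff by (simp add: pres_class_def pres_eq.sym)
  moreover have "u \<in> pres_class R u" and "v \<in> pres_class R v"
    by (simp_all add: pres_class_def pres_eq.refl)
  ultimately have "(\<Union>u'\<in>pres_class R u. \<Union>v'\<in>pres_class R v. pres_class R (u' @ v'))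
      = pres_class R (u @ v)"
    by blast
  then show ?thesis by (simp add: presented_group_def)
qed

lemma pres_eq_inv_left: "pres_eq R (word_inv w @ w) []"
proof (induction w)
  case Nil
  show ?case by (simp add: word_inv_def pres_eq.refl)
next
  case (Cons a w)
  obtain g b where a: "a = (g, b)" by fastforce
  have "pres_eq R (word_inv w @ [(g, \<not> b), (g, \<not> \<not> b)] @ w) (word_inv w @ w)"
    by (rule pres_eq.cancel)
  then have "pres_eq R (word_inv (a # w) @ a # w) (word_inv w @ w)"
    by (simp add: a word_inv_def)
  then show ?case using Cons.IH by (rule pres_eq.trans)
qed

lemma group_presented_group: "group (presented_group R)"
proof (rule groupI)
  fix A assume "A \<in> carrier (presented_group R)"
  then obtain w where w: "A = pres_class R w" by (auto simp: presented_group_def)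
  have "pres_class R (word_inv w) \<otimes>\<^bsub>presented_group R\<^esub> A = \<one>\<^bsub>presented_group R\<^esub>"
    using pres_eq_inv_left[of R w]
    by (simp add: w presented_group_mult pres_class_eq_iff)
       (simp add: presented_group_def pres_class_eq_iff)
  then show "\<exists>B\<in>carrier (presented_group R).
      B \<otimes>\<^bsub>presented_group R\<^esub> A = \<one>\<^bsub>presented_group R\<^esub>"
    by (auto simp: presented_group_def)
next
  have one: "\<one>\<^bsub>presented_group R\<^esub> = pres_class R []"
    and car: "carrier (presented_group R) = range (pres_class R)"
    by (simp_all add: presented_group_def)
  show "\<one>\<^bsub>presented_group R\<^esub> \<in> carrier (presented_group R)"
    by (simp add: one car)
  show "A \<otimes>\<^bsub>presented_group R\<^esub> B \<in> carrier (presented_group R)"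
    if "A \<in> carrier (presented_group R)" "B \<in> carrier (presented_group R)" for A B
    using that by (auto simp: car presented_group_mult)
  show "A \<otimes>\<^bsub>presented_group R\<^esub> B \<otimes>\<^bsub>presented_group R\<^esub> C
      = A \<otimes>\<^bsub>presented_group R\<^esub> (B \<otimes>\<^bsub>presented_group R\<^esub> C)"
    if "A \<in> carrier (presented_group R)" "B \<in> carrier (presented_group R)"
      "C \<in> carrier (presented_group R)" for A B C
    using that by (auto simp: car presented_group_mult)
  show "\<one>\<^bsub>presented_group R\<^esub> \<otimes>\<^bsub>presented_group R\<^esub> A = A"
    if "A \<in> carrier (presented_group R)" for A
    using that by (auto simp: car one presented_group_mult)
qed

datatype gen = GenX | GenY | GenZ

abbreviation wx :: "gen word" where "wx \<equiv> [(GenX, True)]"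
abbreviation wy :: "gen word" where "wy \<equiv> [(GenY, True)]"
abbreviation wz :: "gen word" where "wz \<equiv> [(GenZ, True)]"

definition pi1_G1 :: "(int \<times> int \<times> int) monoid" where
  "pi1_G1 = integer_group \<times>\<times> integer_group \<times>\<times> integer_group"

definition pi1_G2 :: "gen word set monoid" where
  "pi1_G2 = presented_group
    {(wx @ wy @ word_inv wx @ word_inv wy, []),
     (word_conj wx wz, word_inv wx),
     (word_conj wy wz, word_inv wy)}"

definition pi1_G6 :: "gen word set monoid" where
  "pi1_G6 = presented_group
    {(wx @ wy @ wy @ word_inv wx @ wy @ wy, []),
     (wy @ wx @ wx @ word_inv wy @ wx @ wx, []),
     (wx @ wy @ wz, [])}"

(* For n > 0 the condition card (rcosets) = n forces the index to be finite. *)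
definition subgroups_iso ::
    "('b, 'c) monoid_scheme \<Rightarrow> 'a monoid \<Rightarrow> nat \<Rightarrow> 'a set set" where
  "subgroups_iso K G n =
    {H. subgroup H G \<and> card (rcosets\<^bsub>G\<^esub> H) = n \<and> G\<lparr>carrier := H\<rparr> \<cong> K}"

(* If q is not a positive integer, there are no such triples, so the sums over them are 0. *)
definition factor_triples :: "rat \<Rightarrow> (nat \<times> nat \<times> nat) set" where
  "factor_triples q = {(a, b, c). a > 0 \<and> b > 0 \<and> c > 0 \<and> of_nat (a * b * c) = q}"

definition omega :: "rat \<Rightarrow> int" where
  "omega q = (\<Sum>(a, b, c)\<in>factor_triples q. int a ^ 2 * int b)"

definition d3 :: "rat \<Rightarrow> int" where
  "d3 q = (\<Sum>(a, b, c)\<in>factor_triples q. 1)"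

lemma finite_factor_triples: "finite (factor_triples q)"
proof (cases "\<exists>n. q = of_nat n")
  case True
  then obtain n where n: "q = of_nat n" by blast
  have "factor_triples q \<subseteq> {..n} \<times> {..n} \<times> {..n}"
  proof
    fix t assume "t \<in> factor_triples q"
    then obtain a b c where t: "t = (a, b, c)" and pos: "a > 0" "b > 0" "c > 0"
      and "of_nat (a * b * c) = (of_nat n :: rat)"
      by (auto simp: factor_triples_def n)
    then have abc: "a * b * c = n" by (simp only: of_nat_eq_iff)
    have "a dvd n" "b dvd n" "c dvd n" using abc by auto
    moreover have "n > 0" using abc pos by auto
    ultimately show "t \<in> {..n} \<times> {..n} \<times> {..n}"
      by (auto simp: t dest: dvd_imp_le)
  qed
  then show ?thesis by (rule finite_subset) auto
next
  case False
  then have "factor_triples q = {}" by (auto simp: factor_triples_def simp del: of_nat_mult)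
  then show ?thesis by simp
qed

end

(*
  The group of the Hantzsche-Wendt manifold G6 is realised as the set hw of integer vectors with
  even coordinate sum under a twisted addition, and the groups of G1 and G2 as two extensions of
  Z^2 by Z.  A subgroup of finite index of such an extension is determined by the generator l of its
  image in Z, the Hermite normal form ((a, 0), (r, b)) of its intersection with Z^2 and the class
  (u, v) modulo that lattice of a lift of l; since 0 <= r, u < a and 0 <= v < b, there are omega(n)
  subgroups of index n = a b l, whatever the action.

  The parities of the coordinates map hw onto the Klein four-group.  Subgroups with trivial image lie
  in the lattice of translations, which has index 4, and those with an image of order two lie in one
  of three subgroups of index 2 isomorphic to the group of G2; this gives (i) and (ii).  A subgroup
  with full image meets the translations in a box 2pZ x 2qZ x 2rZ with p, q, r odd, and is
  the conjugate of hw under an affine map (x, y, z) |-> (p x + u, q y + v, r z + w) with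
  0 <= u < p, 0 <= v < q, 0 <= w < r.  So there are n of them for every odd factorisation n = p q r,
  and the odd triples are counted by inclusion-exclusion.
*)
theory Submission imports Defs begin

section \<open>Subgroups and their indices\<close>

text \<open>Inversion maps every sublattice of Z^2 to itself, and a power of a lift of
  \<open>l\<close> that has third coordinate 0 is trivial. So every lattice and every class of lifts
  define a subgroup that meets Z^2 in exactly that lattice, and the action cannot influence the
  count. In a subgroup with full image, a translation conjugated by an element of nontrivial image
  and multiplied by the translation itself retains only one coordinate, doubled. The square of such
  an element is a translation by twice an odd number along one axis, so the sides are odd; the
  factor 2 cancels and the translations form a box. Oddness also makes the affine maps work: odd
  scaling preserves the parities, on which all signs depend, and 2 is invertible modulo each side.
  The counts ask for isomorphism types, whereas the analysis sorts by image. Both agree because, of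
  the three groups, only Z^3 is abelian and only the group of G6 has no nonzero homomorphism to
  Z.\<close>

lemma (in group) bij_betw_transversal:
  assumes H: "subgroup H G" and \<tau>: "\<And>i. i \<in> I \<Longrightarrow> \<tau> i \<in> carrier G"
    and ex1: "\<And>g. g \<in> carrier G \<Longrightarrow> \<exists>!i. i \<in> I \<and> g \<in> H #> \<tau> i"
  shows "bij_betw (\<lambda>i. H #> \<tau> i) I (rcosets H)"
proof (rule bij_betw_imageI)
  show "inj_on (\<lambda>i. H #> \<tau> i) I"
  proof (rule inj_onI)
    fix i j assume "i \<in> I" "j \<in> I" "H #> \<tau> i = H #> \<tau> j"
    moreover from this have "\<tau> i \<in> H #> \<tau> i" "\<tau> i \<in> H #> \<tau> j"
      using rcos_self[OF \<tau> H] by auto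
    ultimately show "i = j" using ex1[OF \<tau>] by blast
  qed
  show "(\<lambda>i. H #> \<tau> i) ` I = rcosets H"
  proof
    show "(\<lambda>i. H #> \<tau> i) ` I \<subseteq> rcosets H"
      using \<tau> by (auto simp: RCOSETS_def)
    show "rcosets H \<subseteq> (\<lambda>i. H #> \<tau> i) ` I"
    proof
      fix C assume "C \<in> rcosets H"
      then obtain g where g: "g \<in> carrier G" "C = H #> g" by (auto simp: RCOSETS_def)
      then obtain i where "i \<in> I" "g \<in> H #> \<tau> i" using ex1 by blast
      then show "C \<in> (\<lambda>i. H #> \<tau> i) ` I"
        using repr_independence[OF _ _ H] \<tau> g by blast
    qed
  qed
qed

lemma (in group) ex_transversal:
  assumes H: "subgroup H G"
  obtains \<sigma> where "\<And>C. C \<in> rcosets H \<Longrightarrow> \<sigma> C \<in> carrier G"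
    and "\<And>g. g \<in> carrier G \<Longrightarrow> \<exists>!C. C \<in> rcosets H \<and> g \<in> H #> \<sigma> C"
proof -
  define \<sigma> where "\<sigma> C = (SOME c. c \<in> carrier G \<and> H #> c = C)" for C
  have \<sigma>: "\<sigma> C \<in> carrier G \<and> H #> \<sigma> C = C" if "C \<in> rcosets H" for C
    unfolding \<sigma>_def using that by - (rule someI_ex, auto simp: RCOSETS_def)
  have "\<exists>!C. C \<in> rcosets H \<and> g \<in> H #> \<sigma> C" if g: "g \<in> carrier G" for g
  proof (rule ex1I[of _ "H #> g"])
    show "H #> g \<in> rcosets H \<and> g \<in> H #> \<sigma> (H #> g)"
      using g \<sigma> rcosetsI[OF subgroup.subset[OF H]] rcos_self[OF g H] by auto
    fix C assume "C \<in> rcosets H \<and> g \<in> H #> \<sigma> C"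
    then have C: "C \<in> rcosets H" "g \<in> H #> \<sigma> C" by auto
    have "\<sigma> C \<in> carrier G" and eq: "H #> \<sigma> C = C" using \<sigma>[OF C(1)] by auto
    then have "H #> \<sigma> C = H #> g" using repr_independence[OF C(2) _ H] by blast
    with eq show "C = H #> g" by metis
  qed
  with \<sigma> show ?thesis by (intro that[of \<sigma>]) simp_all
qed

text \<open>The index is multiplicative: if the \<open>\<sigma> C\<close> represent the cosets of
  \<open>H\<close> in \<open>K\<close>, and \<open>T\<close> those of the image of \<open>K\<close>
  in \<open>G\<close>, their products represent the cosets of the image of \<open>H\<close>.
  Infinite sets have \<open>card\<close> 0, so infinite indices are covered as well.\<close>

lemma card_rcosets_image:
  assumes K: "group K" and G: "group G" and \<psi>: "\<psi> \<in> hom K G" and inj: "inj_on \<psi> (carrier K)"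
    and H: "subgroup H K" and T: "T \<subseteq> carrier G"
    and ex1: "\<And>g. g \<in> carrier G \<Longrightarrow> \<exists>!t. t \<in> T \<and> g \<in> \<psi> ` carrier K #>\<^bsub>G\<^esub> t"
  shows "card (rcosets\<^bsub>G\<^esub> (\<psi> ` H)) = card (rcosets\<^bsub>K\<^esub> H) * card T"
proof -
  interpret K: group K by fact
  interpret G: group G by fact
  interpret \<psi>: group_hom K G \<psi> by unfold_locales fact
  obtain \<sigma> where \<sigma>: "\<And>C. C \<in> rcosets\<^bsub>K\<^esub> H \<Longrightarrow> \<sigma> C \<in> carrier K"
    and ex\<sigma>: "\<And>g. g \<in> carrier K \<Longrightarrow> \<exists>!C. C \<in> rcosets\<^bsub>K\<^esub> H \<and> g \<in> H #>\<^bsub>K\<^esub> \<sigma> C"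
    by (rule K.ex_transversal[OF H]) (rule that)
  have Hc: "h \<in> carrier K" if "h \<in> H" for h using subgroup.mem_carrier[OF H that] .
  have "bij_betw (\<lambda>i. \<psi> ` H #>\<^bsub>G\<^esub> (case i of (C, t) \<Rightarrow> \<psi> (\<sigma> C) \<otimes>\<^bsub>G\<^esub> t))
      ((rcosets\<^bsub>K\<^esub> H) \<times> T) (rcosets\<^bsub>G\<^esub> (\<psi> ` H))"
  proof (rule G.bij_betw_transversal)
    show "subgroup (\<psi> ` H) G" by (rule \<psi>.subgroup_img_is_subgroup[OF H])
    show "(case i of (C, t) \<Rightarrow> \<psi> (\<sigma> C) \<otimes>\<^bsub>G\<^esub> t) \<in> carrier G" if "i \<in> (rcosets\<^bsub>K\<^esub> H) \<times> T" for i
      using that T \<sigma> by auto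
    fix g assume g: "g \<in> carrier G"
    obtain t k where t: "t \<in> T" and k: "k \<in> carrier K" and gk: "g = \<psi> k \<otimes>\<^bsub>G\<^esub> t"
      using ex1[OF g] by (auto simp: r_coset_def)
    obtain C h where C: "C \<in> rcosets\<^bsub>K\<^esub> H" and h: "h \<in> H" and kh: "k = h \<otimes>\<^bsub>K\<^esub> \<sigma> C"
      using ex\<sigma>[OF k] by (auto simp: r_coset_def)
    show "\<exists>!i. i \<in> (rcosets\<^bsub>K\<^esub> H) \<times> T \<and> g \<in> \<psi> ` H #>\<^bsub>G\<^esub> (case i of (C, t) \<Rightarrow> \<psi> (\<sigma> C) \<otimes>\<^bsub>G\<^esub> t)"
    proof (rule ex1I[of _ "(C, t)"])
      have "g = \<psi> h \<otimes>\<^bsub>G\<^esub> (\<psi> (\<sigma> C) \<otimes>\<^bsub>G\<^esub> t)"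
        using C h t T gk kh \<sigma> Hc by (auto simp: G.m_assoc)
      then show "(C, t) \<in> (rcosets\<^bsub>K\<^esub> H) \<times> T \<and>
          g \<in> \<psi> ` H #>\<^bsub>G\<^esub> (case (C, t) of (C, t) \<Rightarrow> \<psi> (\<sigma> C) \<otimes>\<^bsub>G\<^esub> t)"
        using C t h by (auto simp: r_coset_def)
    next
      fix i assume i: "i \<in> (rcosets\<^bsub>K\<^esub> H) \<times> T \<and>
          g \<in> \<psi> ` H #>\<^bsub>G\<^esub> (case i of (C, t) \<Rightarrow> \<psi> (\<sigma> C) \<otimes>\<^bsub>G\<^esub> t)"
      obtain C' t' where i': "i = (C', t')" by (cases i)
      obtain h' where C': "C' \<in> rcosets\<^bsub>K\<^esub> H" and t': "t' \<in> T" and h': "h' \<in> H"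
        and g': "g = \<psi> h' \<otimes>\<^bsub>G\<^esub> (\<psi> (\<sigma> C') \<otimes>\<^bsub>G\<^esub> t')"
        using i i' by (auto simp: r_coset_def)
      have g'': "g = \<psi> (h' \<otimes>\<^bsub>K\<^esub> \<sigma> C') \<otimes>\<^bsub>G\<^esub> t'"
        using C' h' t' T g' \<sigma> Hc by (auto simp: G.m_assoc)
      have "h' \<otimes>\<^bsub>K\<^esub> \<sigma> C' \<in> carrier K" using h' C' \<sigma> Hc by simp
      then have "g \<in> \<psi> ` carrier K #>\<^bsub>G\<^esub> t'" using g'' by (auto simp: r_coset_def)
      moreover have "g \<in> \<psi> ` carrier K #>\<^bsub>G\<^esub> t" using gk k by (auto simp: r_coset_def)
      ultimately have "t' = t" using ex1[OF g] t t' by metis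
      then have "\<psi> (h' \<otimes>\<^bsub>K\<^esub> \<sigma> C') = \<psi> k"
        using g'' gk t T k \<open>h' \<otimes>\<^bsub>K\<^esub> \<sigma> C' \<in> carrier K\<close> by (auto simp: subset_iff)
      then have "h' \<otimes>\<^bsub>K\<^esub> \<sigma> C' = k" by (rule inj_onD[OF inj]) fact+
      then have "k \<in> H #>\<^bsub>K\<^esub> \<sigma> C'" using h' by (auto simp: r_coset_def)
      moreover have "k \<in> H #>\<^bsub>K\<^esub> \<sigma> C" using kh h by (auto simp: r_coset_def)
      ultimately have "C' = C" using ex\<sigma>[OF k] C C' by metis
      with \<open>t' = t\<close> show "i = (C, t)" using i' by simp
    qed
  qed
  then show ?thesis by (metis bij_betw_same_card card_cartesian_product)
qed

lemma card_rcosets_iso: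
  assumes K: "group K" and G: "group G" and \<psi>: "\<psi> \<in> iso K G" and H: "subgroup H K"
  shows "card (rcosets\<^bsub>G\<^esub> (\<psi> ` H)) = card (rcosets\<^bsub>K\<^esub> H)"
proof -
  interpret G: group G by fact
  have im: "\<psi> ` carrier K = carrier G" and inj: "inj_on \<psi> (carrier K)" and hom: "\<psi> \<in> hom K G"
    using \<psi> by (auto simp: iso_def bij_betw_def)
  have "card (rcosets\<^bsub>G\<^esub> (\<psi> ` H)) = card (rcosets\<^bsub>K\<^esub> H) * card {\<one>\<^bsub>G\<^esub>}"
    by (rule card_rcosets_image[OF K G hom inj H]) (auto simp: im r_coset_def)
  then show ?thesis by simp
qed

lemma (in group_hom) restrict_iso:
  assumes "inj_on h (carrier G)" and "subgroup J G"
  shows "G\<lparr>carrier := J\<rparr> \<cong> H\<lparr>carrier := h ` J\<rparr>"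
proof (rule is_isoI)
  have "J \<subseteq> carrier G" using assms(2) by (rule subgroup.subset)
  then show "h \<in> iso (G\<lparr>carrier := J\<rparr>) (H\<lparr>carrier := h ` J\<rparr>)"
    using assms(1) by (auto simp: iso_def hom_def bij_betw_def inj_on_subset subset_iff)
qed

lemma (in group) image_iso:
  assumes "group K" and "\<phi> \<in> hom K G" and "inj_on \<phi> (carrier K)"
  shows "G\<lparr>carrier := \<phi> ` carrier K\<rparr> \<cong> K"
proof -
  interpret \<phi>: group_hom K G \<phi> using assms by (simp add: group_hom_def group_hom_axioms_def)
  have "\<phi> \<in> iso K (G\<lparr>carrier := \<phi> ` carrier K\<rparr>)"
    using assms by (auto simp: iso_def hom_def bij_betw_def)
  then show ?thesis using \<phi>.G.iso_sym is_isoI by blast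
qed

text \<open>Carries the counts from the presented groups to their coordinate models; the ambient
  group and the isomorphism type are replaced at once.\<close>

lemma bij_betw_subgroups_iso:
  assumes G: "group G" and G': "group G'" and \<psi>: "\<psi> \<in> iso G G'"
    and K: "group K" "K \<cong> K'"
  shows "bij_betw ((`) \<psi>) (subgroups_iso K G n) (subgroups_iso K' G' n)"
proof -
  interpret G: group G by fact
  interpret G': group G' by fact
  have hom: "\<psi> \<in> hom G G'" and inj: "inj_on \<psi> (carrier G)" and im: "\<psi> ` carrier G = carrier G'"
    using \<psi> by (auto simp: iso_def bij_betw_def)
  interpret h: group_hom G G' \<psi> by unfold_locales fact
  have iso: "G\<lparr>carrier := H\<rparr> \<cong> K \<longleftrightarrow> G'\<lparr>carrier := \<psi> ` H\<rparr> \<cong> K'" if H: "subgroup H G" for H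
  proof -
    have *: "G\<lparr>carrier := H\<rparr> \<cong> G'\<lparr>carrier := \<psi> ` H\<rparr>"
      by (rule h.restrict_iso[OF inj H])
    have g: "group (G\<lparr>carrier := H\<rparr>)" using H G by (rule subgroup.subgroup_is_group)
    have **: "G'\<lparr>carrier := \<psi> ` H\<rparr> \<cong> G\<lparr>carrier := H\<rparr>" by (rule group.iso_sym[OF g *])
    show ?thesis
    proof
      assume "G\<lparr>carrier := H\<rparr> \<cong> K"
      from iso_trans[OF iso_trans[OF ** this] K(2)]
      show "G'\<lparr>carrier := \<psi> ` H\<rparr> \<cong> K'" .
    next
      assume "G'\<lparr>carrier := \<psi> ` H\<rparr> \<cong> K'"
      from iso_trans[OF iso_trans[OF * this] group.iso_sym[OF K]]
      show "G\<lparr>carrier := H\<rparr> \<cong> K" .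
    qed
  qed
  show ?thesis
  proof (rule bij_betw_imageI)
    show "inj_on ((`) \<psi>) (subgroups_iso K G n)"
      using inj_on_image_eq_iff[OF inj subgroup.subset subgroup.subset]
      by (intro inj_onI) (simp add: subgroups_iso_def)
    show "(`) \<psi> ` subgroups_iso K G n = subgroups_iso K' G' n"
    proof
      show "(`) \<psi> ` subgroups_iso K G n \<subseteq> subgroups_iso K' G' n"
        using card_rcosets_iso[OF G G' \<psi>] iso
        by (auto simp: subgroups_iso_def h.subgroup_img_is_subgroup)
      show "subgroups_iso K' G' n \<subseteq> (`) \<psi> ` subgroups_iso K G n"
      proof
        fix J assume J: "J \<in> subgroups_iso K' G' n"
        define H where "H = inv_into (carrier G) \<psi> ` J"
        have sJ: "subgroup J G'" using J by (simp add: subgroups_iso_def)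
        have inv: "inv_into (carrier G) \<psi> \<in> iso G' G" using \<psi> by (rule G.iso_set_sym)
        then interpret i: group_hom G' G "inv_into (carrier G) \<psi>"
          by unfold_locales (simp add: iso_def)
        have H: "subgroup H G" unfolding H_def by (rule i.subgroup_img_is_subgroup[OF sJ])
        have "\<psi> ` H = J"
          unfolding H_def by (rule image_inv_into_cancel[OF im subgroup.subset[OF sJ]])
        then show "J \<in> (`) \<psi> ` subgroups_iso K G n"
          using J H card_rcosets_iso[OF G G' \<psi> H] iso[OF H]
          by (auto simp: subgroups_iso_def)
      qed
    qed
  qed
qed

text \<open>Pigeonhole: infinitely many \<open>f m\<close> fall into finitely many cosets. Applied
  along a coordinate axis, it yields a nonzero element of \<open>H\<close> on that axis.\<close>

lemma (in group) ex_diff_mem_finite_index: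
  fixes f :: "int \<Rightarrow> 'a"
  assumes H: "subgroup H G" and fin: "finite (rcosets H)" and f: "\<And>m. f m \<in> carrier G"
  obtains m m' where "m \<noteq> m'" and "f m \<otimes> inv f m' \<in> H"
proof -
  have "range (\<lambda>m. H #> f m) \<subseteq> rcosets H" using f by (auto simp: RCOSETS_def)
  then have "finite (range (\<lambda>m. H #> f m))" using fin by (rule finite_subset)
  then have "\<not> inj (\<lambda>m. H #> f m)" using finite_imageD infinite_UNIV_int by blast
  then obtain m m' where m: "m \<noteq> m'" "H #> f m = H #> f m'" by (auto simp: inj_def)
  have "f m \<in> H #> f m'" using rcos_self[OF f H] m(2) by blast
  then have "f m \<otimes> inv f m' \<in> H"
    using subgroup.rcos_module_imp[OF H is_group f] by blast
  with m(1) that show ?thesis by blast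
qed

lemma (in group_hom) subgroup_preimage:
  assumes J: "subgroup J H"
  shows "subgroup {t \<in> carrier G. h t \<in> J} G"
proof (rule G.subgroupI)
  show "{t \<in> carrier G. h t \<in> J} \<noteq> {}" using subgroup.one_closed[OF J] by auto
qed (auto intro: subgroup.m_closed[OF J] subgroup.m_inv_closed[OF J])

section \<open>Commuting and inverting elements of a group\<close>

context group
begin

lemma cancel_inv_assoc:
  assumes "x \<in> carrier G" "y \<in> carrier G"
  shows "x \<otimes> (inv x \<otimes> y) = y" and "inv x \<otimes> (x \<otimes> y) = y"
  using assms by (simp_all add: m_assoc[symmetric])

lemma inv_commute:
  assumes "x \<in> carrier G" "y \<in> carrier G" "x \<otimes> y = y \<otimes> x"
  shows "inv x \<otimes> y = y \<otimes> inv x"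
proof -
  have "inv x \<otimes> y = inv x \<otimes> (y \<otimes> x) \<otimes> inv x" using assms(1,2) by (simp add: m_assoc)
  also have "\<dots> = y \<otimes> inv x" using assms(1,2) by (simp add: assms(3)[symmetric] m_assoc[symmetric])
  finally show ?thesis .
qed

lemma int_pow_commute:
  assumes "x \<in> carrier G" "y \<in> carrier G" "x \<otimes> y = y \<otimes> x"
  shows "x [^] (i :: int) \<otimes> y = y \<otimes> x [^] i"
proof -
  have "x [^] n \<otimes> y = y \<otimes> x [^] n" for n :: nat
    using assms by (metis group_commutes_pow)
  then show ?thesis
    using assms inv_commute[of "x [^] _" y]
    by (cases i rule: int_cases2) (auto simp: int_pow_int int_pow_neg_int)
qed

lemma int_pows_commute:
  assumes "x \<in> carrier G" "y \<in> carrier G" "x \<otimes> y = y \<otimes> x"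
  shows "x [^] (i :: int) \<otimes> y [^] (j :: int) = y [^] j \<otimes> x [^] i"
  using int_pow_commute[of y "x [^] i" j] int_pow_commute[OF assms, of i] assms by simp

lemma inverting_facts:
  assumes x: "x \<in> carrier G" and z: "z \<in> carrier G" and zx: "z \<otimes> x = inv x \<otimes> z"
  shows "x \<otimes> z = z \<otimes> inv x" and "z \<otimes> z \<otimes> x = x \<otimes> (z \<otimes> z)"
    and "inv z \<otimes> x = inv x \<otimes> inv z"
proof -
  have "x \<otimes> z \<otimes> x = z" using x z by (simp add: zx m_assoc) (simp add: m_assoc[symmetric])
  then show xz: "x \<otimes> z = z \<otimes> inv x" using x z by (simp add: inv_solve_right)
  show "z \<otimes> z \<otimes> x = x \<otimes> (z \<otimes> z)"
    using x z by (metis zx xz m_assoc inv_closed)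
  have "inv (inv x \<otimes> z) = inv (z \<otimes> x)" by (simp add: zx)
  then show "inv z \<otimes> x = inv x \<otimes> inv z" using x z by (simp add: inv_mult_group)
qed

end

section \<open>Sets of integers closed under differences\<close>

lemma int_diff_closed_eq_multiples:
  fixes S :: "int set"
  assumes diff: "\<And>x y. x \<in> S \<Longrightarrow> y \<in> S \<Longrightarrow> x - y \<in> S" and x: "x \<in> S" "x \<noteq> 0"
  obtains d where "d > 0" and "\<And>y. y \<in> S \<longleftrightarrow> d dvd y"
proof -
  have zero: "0 \<in> S" using diff[OF x(1) x(1)] by simp
  have neg: "- y \<in> S" if "y \<in> S" for y using diff[OF zero that] by simp
  have add: "y + z \<in> S" if "y \<in> S" "z \<in> S" for y z using diff[OF that(1) neg[OF that(2)]] by simp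
  have nmult: "int n * y \<in> S" if "y \<in> S" for n y
    by (induction n) (auto simp: zero algebra_simps intro: add that)
  have mult: "m * y \<in> S" if "y \<in> S" for m y
    using nmult[OF that] neg[OF nmult[OF that]] by (cases m rule: int_cases2) auto
  define n where "n = (LEAST n. n > 0 \<and> int n \<in> S)"
  have "nat \<bar>x\<bar> > 0 \<and> int (nat \<bar>x\<bar>) \<in> S" using x neg by (auto simp: abs_if)
  then have n: "n > 0" "int n \<in> S" unfolding n_def by (metis (mono_tags, lifting) LeastI)+
  have least: "m \<ge> n" if "m > 0" "int m \<in> S" for m
    unfolding n_def using that by (intro Least_le) simp
  have "y \<in> S \<longleftrightarrow> int n dvd y" for y
  proof
    assume y: "y \<in> S"
    have "y mod int n = y - (y div int n) * int n" by (simp add: minus_div_mult_eq_mod)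
    then have *: "y mod int n \<in> S" using diff[OF y mult[OF n(2)]] by simp
    have bound: "y mod int n < int n" "y mod int n \<ge> 0" using n(1) by simp_all
    have "\<not> y mod int n > 0"
    proof
      assume "y mod int n > 0"
      then have "nat (y mod int n) \<ge> n" using * by (intro least) auto
      then show False using bound by linarith
    qed
    then show "int n dvd y" using bound by (simp add: dvd_eq_mod_eq_0)
  next
    assume "int n dvd y"
    then show "y \<in> S" using mult[OF n(2)] by (auto simp: dvd_def mult.commute)
  qed
  with n(1) show ?thesis by (intro that[of "int n"]) auto
qed

text \<open>Serves as induction over the integers: the instances are sets like
  \<open>{i. (i, 0, 0) \<in> J}\<close>, whose closure under differences is a single computation in
  the group. The positive generator divides 1 and therefore everything.\<close>

lemma int_diff_closed_eq_UNIV: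
  fixes S :: "int set"
  assumes "\<And>x y. x \<in> S \<Longrightarrow> y \<in> S \<Longrightarrow> x - y \<in> S" and "1 \<in> S"
  shows "x \<in> S"
  using int_diff_closed_eq_multiples[OF assms(1,2)]
  by (metis assms(2) one_dvd one_neq_zero zdvd_antisym_nonneg dvd_trans)

lemma int_eq_if_dvd_iff:
  fixes x y :: int
  assumes "\<And>z. x dvd z \<longleftrightarrow> y dvd z" and "x > 0" "y > 0"
  shows "x = y"
proof (rule zdvd_antisym_nonneg)
  show "x dvd y" using assms(1)[of y] by simp
  show "y dvd x" using assms(1)[of x] by simp
qed (use assms in simp_all)

lemma int_eq_if_dvd_diff:
  fixes d x y :: int
  assumes "d dvd x - y" "0 \<le> x" "x < d" "0 \<le> y" "y < d"
  shows "x = y"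
  using assms by (metis mod_eq_dvd_iff mod_pos_pos_trivial)

section \<open>Groups given by presentations\<close>

primrec word_eval :: "('a, 'b) monoid_scheme \<Rightarrow> ('g \<Rightarrow> 'a) \<Rightarrow> 'g word \<Rightarrow> 'a" where
  "word_eval G h [] = \<one>\<^bsub>G\<^esub>"
| "word_eval G h (l # w) =
    (if snd l then h (fst l) else inv\<^bsub>G\<^esub> h (fst l)) \<otimes>\<^bsub>G\<^esub> word_eval G h w"

context group
begin

context
  fixes h :: "'g \<Rightarrow> 'a"
  assumes h: "\<And>g. h g \<in> carrier G"
begin

lemma word_eval_closed: "word_eval G h w \<in> carrier G"
  by (induction w) (auto simp: h)

lemma word_eval_append: "word_eval G h (v @ w) = word_eval G h v \<otimes> word_eval G h w"
  by (induction v) (auto simp: h m_assoc word_eval_closed)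

lemma word_eval_pres_eq:
  assumes R: "\<And>l r. (l, r) \<in> R \<Longrightarrow> word_eval G h l = word_eval G h r"
    and "pres_eq R v w"
  shows "word_eval G h v = word_eval G h w"
  using assms(2)
proof (induction rule: pres_eq.induct)
  case (cancel u g b v)
  have "word_eval G h ([(g, b), (g, \<not> b)] @ v) = word_eval G h v"
    by (cases b) (auto simp: h m_assoc[symmetric] word_eval_closed)
  then show ?case by (simp only: word_eval_append)
next
  case (rel l r u v)
  then show ?case using R by (simp add: word_eval_append)
qed auto

text \<open>The map \<open>N\<close> sends an element to the class of its normal form; compatibility with right
  multiplication by generators makes it a left inverse of the evaluation of words.\<close>

lemma presented_group_iso:
  fixes R N
  defines "P \<equiv> presented_group R"
  assumes R: "\<And>l r. (l, r) \<in> R \<Longrightarrow> word_eval G h l = word_eval G h r"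
    and gen: "\<And>J. subgroup J G \<Longrightarrow> range h \<subseteq> J \<Longrightarrow> carrier G \<subseteq> J"
    and N: "\<And>t. t \<in> carrier G \<Longrightarrow> N t \<in> carrier P" "N \<one> = \<one>\<^bsub>P\<^esub>"
    and N_mult: "\<And>t g. t \<in> carrier G \<Longrightarrow> N (t \<otimes> h g) = N t \<otimes>\<^bsub>P\<^esub> pres_class R [(g, True)]"
  shows "P \<cong> G"
proof -
  interpret P: group P unfolding P_def by (rule group_presented_group)
  have carP: "carrier P = range (pres_class R)" and oneP: "\<one>\<^bsub>P\<^esub> = pres_class R []"
    by (simp_all add: P_def presented_group_def)
  have multP: "pres_class R v \<otimes>\<^bsub>P\<^esub> pres_class R w = pres_class R (v @ w)" for v w
    unfolding P_def by (rule presented_group_mult)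
  define f where "f A = word_eval G h (SOME w. A = pres_class R w)" for A
  have f: "f (pres_class R w) = word_eval G h w" for w
  proof -
    define v where "v = (SOME v. pres_class R w = pres_class R v)"
    have "pres_class R w = pres_class R v" unfolding v_def by (rule someI) simp
    then have "pres_eq R w v" by (simp add: pres_class_eq_iff)
    then show ?thesis using word_eval_pres_eq[OF R] by (simp add: f_def v_def)
  qed
  have hom: "f \<in> hom P G"
    by (auto simp: hom_def carP f word_eval_closed multP word_eval_append)
  then interpret f: group_hom P G f by unfold_locales
  \<comment> \<open>Inverse letters reduce to positive ones: \<open>N_mult\<close> is applied at
    \<open>t\<close> times the inverse generator, and the letter is cancelled on the right.\<close>
  have N_inv: "N (t \<otimes> inv h g) = N t \<otimes>\<^bsub>P\<^esub> pres_class R [(g, False)]"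
    if t: "t \<in> carrier G" for t g
  proof -
    have "N t = N (t \<otimes> inv h g) \<otimes>\<^bsub>P\<^esub> pres_class R [(g, True)]"
      using N_mult[of "t \<otimes> inv h g" g] t h by (simp add: m_assoc)
    moreover have "pres_class R [(g, True)] \<otimes>\<^bsub>P\<^esub> pres_class R [(g, False)] = \<one>\<^bsub>P\<^esub>"
      using pres_eq.cancel[of R "[]" g True "[]"] by (simp add: multP oneP pres_class_eq_iff)
    ultimately show ?thesis using t h N(1) by (simp add: P.m_assoc carP)
  qed
  \<comment> \<open>At \<open>t = \<one>\<close> this says that \<open>N\<close> undoes evaluation;
    the induction over the word needs it for all \<open>t\<close>.\<close>
  have step: "N (t \<otimes> word_eval G h w) = N t \<otimes>\<^bsub>P\<^esub> pres_class R w" if "t \<in> carrier G" for t w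
    using that
  proof (induction w arbitrary: t)
    case Nil
    then show ?case using N(1) by (simp add: oneP[symmetric])
  next
    case (Cons l w)
    obtain g b where l: "l = (g, b)" by (cases l)
    let ?s = "if b then h g else inv h g"
    have s: "?s \<in> carrier G" using h by simp
    have "N (t \<otimes> word_eval G h (l # w)) = N ((t \<otimes> ?s) \<otimes> word_eval G h w)"
      using Cons.prems s by (auto simp: l m_assoc word_eval_closed h)
    also have "\<dots> = N (t \<otimes> ?s) \<otimes>\<^bsub>P\<^esub> pres_class R w"
      using Cons s by blast
    also have "N (t \<otimes> ?s) = N t \<otimes>\<^bsub>P\<^esub> pres_class R [(g, b)]"
      using Cons.prems N_mult N_inv by auto
    finally show ?case
      using N(1)[OF Cons.prems] by (simp add: P.m_assoc carP multP l)
  qed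
  have "inj_on f (carrier P)"
  proof (rule inj_on_inverseI)
    fix A assume "A \<in> carrier P"
    then obtain w where A: "A = pres_class R w" by (auto simp: carP)
    show "N (f A) = A"
      using step[of \<one> w] by (simp add: A f word_eval_closed N(2)) (simp add: carP)
  qed
  moreover have "f ` carrier P = carrier G"
  proof
    show "f ` carrier P \<subseteq> carrier G" by auto
    have "h g = f (pres_class R [(g, True)])" for g using h by (simp add: f)
    then have "range h \<subseteq> f ` carrier P" unfolding carP by blast
    then show "carrier G \<subseteq> f ` carrier P" by (rule gen[OF f.img_is_subgroup])
  qed
  ultimately have "f \<in> iso P G" using hom by (simp add: iso_def bij_betw_def)
  then show ?thesis by (rule is_isoI)
qed

end

end

text \<open>Makes a defining relation available as an equation between the classes of the
  generators: over these classes every word evaluates to its own class.\<close>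

lemma presented_group_rel:
  fixes R
  defines "P \<equiv> presented_group R" and "c \<equiv> \<lambda>g. pres_class R [(g, True)]"
  assumes "(l, r) \<in> R"
  shows "word_eval P c l = word_eval P c r"
proof -
  interpret P: group P unfolding P_def by (rule group_presented_group)
  have carP: "carrier P = range (pres_class R)" and oneP: "\<one>\<^bsub>P\<^esub> = pres_class R []"
    by (simp_all add: P_def presented_group_def)
  have multP: "pres_class R v \<otimes>\<^bsub>P\<^esub> pres_class R w = pres_class R (v @ w)" for v w
    unfolding P_def by (rule presented_group_mult)
  have "inv\<^bsub>P\<^esub> (c g) = pres_class R [(g, False)]" for g
    using pres_eq.cancel[of R "[]" g False "[]"]
    by (intro P.inv_equality) (auto simp: c_def carP oneP multP pres_class_eq_iff)
  then have "word_eval P c w = pres_class R w" for w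
    by (induction w) (auto simp: oneP multP c_def)
  then show ?thesis
    using pres_eq.rel[OF assms(3), of "[]" "[]"] by (simp add: pres_class_eq_iff)
qed

section \<open>Extensions of \<open>\<int>\<^sup>2\<close> by \<open>\<int>\<close>\<close>

text \<open>The sign by which the \<open>k\<close>-th power of the third generator acts on Z^2. The
  flag \<open>e\<close> switches the action on, so that Z^3 and the group of G2 share one
  development; \<open>twist True\<close> also supplies the signs in the multiplication of
  \<open>hw\<close>.\<close>

definition twist :: "bool \<Rightarrow> int \<Rightarrow> int" where
  "twist e k = (if e \<and> odd k then - 1 else 1)"

lemma twist_simps [simp]:
  "twist e 0 = 1" "twist False k = 1" "twist e (- k) = twist e k"
  "twist e (k + l) = twist e k * twist e l" "twist e k * twist e k = 1"
  "twist e (k - l) = twist e k * twist e l"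
  "twist e (twist e' k * l) = twist e l" "twist e k * (twist e k * m) = m" "even (twist e k * m) \<longleftrightarrow> even m"
  by (auto simp: twist_def)

lemma twist_mult: "twist e (k * l) = twist (e \<and> odd l) k"
  by (auto simp: twist_def)

text \<open>\<open>z \<otimes> z\<close> commutes with \<open>x\<close>, so only the parity of
  \<open>k\<close> matters.\<close>

lemma (in group) int_pow_twist:
  assumes x: "x \<in> carrier G" and z: "z \<in> carrier G" and zx: "z \<otimes> x = inv x \<otimes> z"
  shows "z [^] (k :: int) \<otimes> x = x [^] twist True k \<otimes> z [^] k"
proof -
  have sq: "(z \<otimes> z) [^] (m :: int) \<otimes> x = x \<otimes> (z \<otimes> z) [^] m" for m
    using x z inverting_facts(2)[OF assms] by (intro int_pow_commute) auto
  have z2: "z [^] (2 * m) = (z \<otimes> z) [^] m" for m :: int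
    using z int_pow_pow[of z 2 m] by (simp add: int_pow_mult[of z 1 1, simplified])
  show ?thesis
  proof (cases "even k")
    case True
    then obtain m where "k = 2 * m" by blast
    then show ?thesis using sq[of m] x by (simp add: twist_def z2)
  next
    case False
    then obtain m where k: "k = 2 * m + 1" by (blast elim: oddE)
    have zk: "z [^] k = (z \<otimes> z) [^] m \<otimes> z" using z by (simp add: k int_pow_mult z2)
    have "(z \<otimes> z) [^] m \<otimes> inv x = inv x \<otimes> (z \<otimes> z) [^] m"
      using inv_commute[of x "(z \<otimes> z) [^] m"] sq[of m] x z by simp
    then have "z [^] k \<otimes> x = inv x \<otimes> z [^] k" using x z zx by (simp add: zk m_assoc) (simp add: m_assoc[symmetric])
    then show ?thesis using False x by (simp add: twist_def int_pow_neg)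
  qed
qed

text \<open>The triple \<open>(i, j, k)\<close> encodes the normal form x^i y^j z^k, where x and y
  commute and z acts on both through \<open>twist e\<close>.\<close>

definition semi :: "bool \<Rightarrow> (int \<times> int \<times> int) monoid" where
  "semi e = \<lparr>carrier = UNIV,
    monoid.mult = (\<lambda>(i, j, k) (i', j', k'). (i + twist e k * i', j + twist e k * j', k + k')),
    one = (0, 0, 0)\<rparr>"

lemma semi_simps [simp]:
  "carrier (semi e) = UNIV" "\<one>\<^bsub>semi e\<^esub> = (0, 0, 0)"
  "(i, j, k) \<otimes>\<^bsub>semi e\<^esub> (i', j', k') = (i + twist e k * i', j + twist e k * j', k + k')"
  by (simp_all add: semi_def)

lemma group_semi: "group (semi e)"
proof (rule groupI)
  fix t assume "t \<in> carrier (semi e)"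
  obtain i j k where "t = (i, j, k)" by (cases t)
  then have "(- twist e k * i, - twist e k * j, - k) \<otimes>\<^bsub>semi e\<^esub> t = \<one>\<^bsub>semi e\<^esub>" by simp
  then show "\<exists>s\<in>carrier (semi e). s \<otimes>\<^bsub>semi e\<^esub> t = \<one>\<^bsub>semi e\<^esub>" by (metis UNIV_I semi_simps(1))
qed (auto simp: algebra_simps)

lemma inv_semi [simp]: "inv\<^bsub>semi e\<^esub> (i, j, k) = (- twist e k * i, - twist e k * j, - k)"
  by (rule group.inv_equality[OF group_semi]) auto

lemma semi_generated:
  assumes J: "subgroup J (semi e)" and "(1, 0, 0) \<in> J" "(0, 1, 0) \<in> J" "(0, 0, 1) \<in> J"
  shows "t \<in> J"
proof -
  note m = subgroup.m_closed[OF J] and d = subgroup.m_closed[OF J _ subgroup.m_inv_closed[OF J]]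
  have 1: "(i, 0, 0) \<in> J" for i
    using int_diff_closed_eq_UNIV[of "{i. (i, 0, 0) \<in> J}" i] d[of "(_, 0, 0)" "(_, 0, 0)"] assms by simp
  have 2: "(0, j, 0) \<in> J" for j
    using int_diff_closed_eq_UNIV[of "{j. (0, j, 0) \<in> J}" j] d[of "(0, _, 0)" "(0, _, 0)"] assms by simp
  have 3: "(0, 0, k) \<in> J" for k
    using int_diff_closed_eq_UNIV[of "{k. (0, 0, k) \<in> J}" k] d[of "(0, 0, _)" "(0, 0, _)"] assms by simp
  obtain i j k where "t = (i, j, k)" by (cases t)
  then show ?thesis using m[OF m[OF 1[of i] 2[of j]] 3[of k]] by simp
qed

text \<open>If the third generator acts by inversion, its even powers are central; hence, for odd \<open>l\<close>,
  \<open>(u, v, l)\<^sup>k\<close> has first component \<open>(k mod 2) u\<close> instead of \<open>k u\<close>.\<close>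

definition acc :: "bool \<Rightarrow> int \<Rightarrow> int" where
  "acc e k = (if e then k mod 2 else k)"

text \<open>A cocycle identity; it is what makes \<open>semi_emb\<close>, \<open>axis_emb\<close>
  and \<open>hw_emb\<close> compatible with the signs.\<close>

lemma acc_add: "acc e (k + k') = acc e k + twist e k * acc e k'"
  unfolding acc_def twist_def by (cases "even k"; cases "even k'") (auto, presburger+)

text \<open>The standard generators go to \<open>(a, 0, 0)\<close>, \<open>(r, b, 0)\<close> and
  \<open>(u, v, l)\<close>, that is, to the Hermite basis and the chosen lift. Conjugation by the
  lift inverts only if \<open>e\<close> holds and \<open>l\<close> is odd; hence the domain
  \<open>semi (e \<and> odd l)\<close>, which gives the isomorphism type of the range whenever the
  map is injective.\<close>

definition semi_emb :: "bool \<Rightarrow> int \<Rightarrow> int \<Rightarrow> int \<Rightarrow> int \<Rightarrow> int \<Rightarrow> int \<Rightarrow> int \<times> int \<times> int \<Rightarrow> int \<times> int \<times> int"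
  where "semi_emb e a b l r u v = (\<lambda>(i, j, k).
    (i * a + j * r + acc (e \<and> odd l) k * u, j * b + acc (e \<and> odd l) k * v, k * l))"

lemma semi_emb_apply [simp]: "semi_emb e a b l r u v (i, j, k) =
    (i * a + j * r + acc (e \<and> odd l) k * u, j * b + acc (e \<and> odd l) k * v, k * l)"
  by (simp add: semi_emb_def)

lemma semi_emb_hom: "semi_emb e a b l r u v \<in> hom (semi (e \<and> odd l)) (semi e)"
  by (auto simp: hom_def acc_add twist_mult algebra_simps simp del: de_Morgan_conj)

lemma semi_emb_inj:
  assumes "a > 0" "b > 0" "l > 0"
  shows "inj (semi_emb e a b l r u v)"
  using assms by (auto simp: inj_def)

section \<open>Index, existence and uniqueness of the Hermite normal form\<close>

lemma subgroup_range_semi_emb: "subgroup (range (semi_emb e a b l r u v)) (semi e)"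
  using group_hom.img_is_subgroup[of "semi (e \<and> odd l)" "semi e" "semi_emb e a b l r u v"]
    group_semi semi_emb_hom
  by (simp add: group_hom_def group_hom_axioms_def)

text \<open>The box of reduced remainders is a transversal: division with remainder proceeds from
  the third coordinate down to the first, since a quotient disturbs only the coordinates before
  it.\<close>

lemma card_rcosets_semi_emb:
  assumes pos: "a > 0" "b > 0" "l > 0"
  shows "card (rcosets\<^bsub>semi e\<^esub> (range (semi_emb e a b l r u v))) = nat a * nat b * nat l"
proof -
  let ?H = "range (semi_emb e a b l r u v)"
  let ?I = "{0..<a} \<times> {0..<b} \<times> {0..<l}"
  interpret group "semi e" by (rule group_semi)
  have "bij_betw (\<lambda>t. ?H #>\<^bsub>semi e\<^esub> t) ?I (rcosets\<^bsub>semi e\<^esub> ?H)"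
  proof (rule bij_betw_transversal[OF subgroup_range_semi_emb])
    fix g :: "int \<times> int \<times> int"
    obtain i j k where g: "g = (i, j, k)" by (cases g)
    have mem: "g \<in> ?H #>\<^bsub>semi e\<^esub> (i0, j0, k0) \<longleftrightarrow> (\<exists>i1 j1 k1. k = k1 * l + k0 \<and>
        j = j1 * b + acc (e \<and> odd l) k1 * v + twist e (k1 * l) * j0 \<and>
        i = i1 * a + j1 * r + acc (e \<and> odd l) k1 * u + twist e (k1 * l) * i0)" for i0 j0 k0
      unfolding g r_coset_def by auto
    show "\<exists>!t. t \<in> ?I \<and> g \<in> ?H #>\<^bsub>semi e\<^esub> t"
    proof (rule ex_ex1I)
      define k1 where "k1 = k div l"
      define s where "s = twist e (k1 * l)"
      \<comment> \<open>In the coset equation the sign \<open>s\<close> sits on the remainder. As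
        \<open>s\<close> is its own inverse, multiplying by it gives an ordinary division by
        \<open>b\<close>; this is why the witnesses below are \<open>s * jq\<close> and
        \<open>s * iq\<close>.\<close>
      define j' where "j' = s * (j - acc (e \<and> odd l) k1 * v)"
      define jq jr where j'_def': "jq = j' div b" "jr = j' mod b"
      define i' where "i' = s * (i - s * jq * r - acc (e \<and> odd l) k1 * u)"
      define iq ir where i'_def': "iq = i' div a" "ir = i' mod a"
      have s: "s * (s * x) = x" for x by (simp add: s_def)
      have "j' = jq * b + jr" "i' = iq * a + ir" by (simp_all add: j'_def' i'_def')
      moreover have "s * j' = j - acc (e \<and> odd l) k1 * v"
        "s * i' = i - s * jq * r - acc (e \<and> odd l) k1 * u"
        by (simp_all only: j'_def i'_def s)
      moreover have "k = k1 * l + k mod l" by (simp add: k1_def)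
      ultimately have "g \<in> ?H #>\<^bsub>semi e\<^esub> (ir, jr, k mod l)"
        unfolding mem
        by - (rule exI[of _ "s * iq"], rule exI[of _ "s * jq"], rule exI[of _ k1],
            simp add: s_def[symmetric] algebra_simps)
      then show "\<exists>t. t \<in> ?I \<and> g \<in> ?H #>\<^bsub>semi e\<^esub> t"
        using pos by (intro exI[of _ "(ir, jr, k mod l)"]) (auto simp: j'_def' i'_def')
    next
      fix t t' assume t: "t \<in> ?I \<and> g \<in> ?H #>\<^bsub>semi e\<^esub> t" and t': "t' \<in> ?I \<and> g \<in> ?H #>\<^bsub>semi e\<^esub> t'"
      obtain i0 j0 k0 i0' j0' k0' where tt: "t = (i0, j0, k0)" "t' = (i0', j0', k0')"
        by (cases t; cases t')
      from t[unfolded tt mem] obtain i1 j1 k1 where 1: "k = k1 * l + k0"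
        "j = j1 * b + acc (e \<and> odd l) k1 * v + twist e (k1 * l) * j0"
        "i = i1 * a + j1 * r + acc (e \<and> odd l) k1 * u + twist e (k1 * l) * i0" by blast
      from t'[unfolded tt mem] obtain i1' j1' k1' where 2: "k = k1' * l + k0'"
        "j = j1' * b + acc (e \<and> odd l) k1' * v + twist e (k1' * l) * j0'"
        "i = i1' * a + j1' * r + acc (e \<and> odd l) k1' * u + twist e (k1' * l) * i0'" by blast
      have "k0 - k0' = (k1' - k1) * l" using 1(1) 2(1) by (simp add: algebra_simps)
      then have k0: "k0 = k0'" using t t' tt by (intro int_eq_if_dvd_diff[of l]) auto
      with 1(1) 2(1) pos have k1: "k1 = k1'" by simp
      define s where "s = twist e (k1 * l)"
      have s: "s * (s * x) = x" for x by (simp add: s_def)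
      have "s * (j0 - j0') = (j1' - j1) * b"
        using 1(2) 2(2) unfolding k1[symmetric] s_def[symmetric] by (simp add: algebra_simps)
      then have "j0 - j0' = s * ((j1' - j1) * b)" by (metis s)
      then have j0: "j0 = j0'" using t t' tt by (intro int_eq_if_dvd_diff[of b]) auto
      with 1(2) 2(2) k1 pos have j1: "j1 = j1'" by simp
      have "s * (i0 - i0') = (i1' - i1) * a"
        using 1(3) 2(3) unfolding k1[symmetric] j1[symmetric] s_def[symmetric]
        by (simp add: algebra_simps)
      then have "i0 - i0' = s * ((i1' - i1) * a)" by (metis s)
      then have i0: "i0 = i0'" using t t' tt by (intro int_eq_if_dvd_diff[of a]) auto
      show "t = t'" using tt i0 j0 k0 by simp
    qed
  qed simp
  then have "card (rcosets\<^bsub>semi e\<^esub> ?H) = card ?I" by (simp add: bij_betw_same_card)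
  then show ?thesis by (simp add: mult.assoc)
qed

text \<open>\<open>a\<close> generates the intersection with the first axis, \<open>b\<close> the
  second coordinates of the elements with third coordinate 0, and \<open>l\<close> all third
  coordinates; finite index makes these sets nonzero. Elements that realise \<open>b\<close> and
  \<open>l\<close> are then reduced modulo what is already known.\<close>

lemma semi_finite_index_subgroup:
  assumes H: "subgroup H (semi e)" and fin: "finite (rcosets\<^bsub>semi e\<^esub> H)"
  obtains a b l r u v where "a > 0" "b > 0" "l > 0" "0 \<le> r" "r < a" "0 \<le> u" "u < a" "0 \<le> v" "v < b"
    "H = range (semi_emb e a b l r u v)"
proof -
  interpret group "semi e" by (rule group_semi)
  note m = subgroup.m_closed[OF H] and d = subgroup.m_closed[OF H _ subgroup.m_inv_closed[OF H]]
  have d1: "(i - i', j - j', 0) \<in> H" if "(i, j, 0) \<in> H" "(i', j', 0) \<in> H" for i i' j j'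
    using d[OF that] by simp
  obtain m1 m1' :: int where m1: "m1 \<noteq> m1'" "(m1, 0, 0) \<otimes>\<^bsub>semi e\<^esub> inv\<^bsub>semi e\<^esub> (m1', 0, 0) \<in> H"
    by (rule ex_diff_mem_finite_index[OF H fin, of "\<lambda>m. (m, 0, 0)"]) auto
  obtain m2 m2' :: int where m2: "m2 \<noteq> m2'" "(0, m2, 0) \<otimes>\<^bsub>semi e\<^esub> inv\<^bsub>semi e\<^esub> (0, m2', 0) \<in> H"
    by (rule ex_diff_mem_finite_index[OF H fin, of "\<lambda>m. (0, m, 0)"]) auto
  obtain m3 m3' :: int where m3: "m3 \<noteq> m3'" "(0, 0, m3) \<otimes>\<^bsub>semi e\<^esub> inv\<^bsub>semi e\<^esub> (0, 0, m3') \<in> H"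
    by (rule ex_diff_mem_finite_index[OF H fin, of "\<lambda>m. (0, 0, m)"]) auto
  obtain a where a: "a > 0" "\<And>i. (i, 0, 0) \<in> H \<longleftrightarrow> a dvd i"
  proof (rule int_diff_closed_eq_multiples[of "{i. (i, 0, 0) \<in> H}" "m1 - m1'"])
    show "x - y \<in> {i. (i, 0, 0) \<in> H}" if "x \<in> {i. (i, 0, 0) \<in> H}" "y \<in> {i. (i, 0, 0) \<in> H}" for x y
      using that d1[of x 0 y 0] by simp
    show "m1 - m1' \<in> {i. (i, 0, 0) \<in> H}" "m1 - m1' \<noteq> 0" using m1 by auto
  qed auto
  obtain b where b: "b > 0" "\<And>j. (\<exists>i. (i, j, 0) \<in> H) \<longleftrightarrow> b dvd j"
  proof (rule int_diff_closed_eq_multiples[of "{j. \<exists>i. (i, j, 0) \<in> H}" "m2 - m2'"])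
    show "x - y \<in> {j. \<exists>i. (i, j, 0) \<in> H}"
      if "x \<in> {j. \<exists>i. (i, j, 0) \<in> H}" "y \<in> {j. \<exists>i. (i, j, 0) \<in> H}" for x y
      using that d1 by blast
    show "m2 - m2' \<in> {j. \<exists>i. (i, j, 0) \<in> H}" "m2 - m2' \<noteq> 0" using m2 by auto
  qed auto
  obtain l where l: "l > 0" "\<And>k. (\<exists>i j. (i, j, k) \<in> H) \<longleftrightarrow> l dvd k"
  proof (rule int_diff_closed_eq_multiples[of "{k. \<exists>i j. (i, j, k) \<in> H}" "m3 - m3'"])
    show "x - y \<in> {k. \<exists>i j. (i, j, k) \<in> H}"
      if "x \<in> {k. \<exists>i j. (i, j, k) \<in> H}" "y \<in> {k. \<exists>i j. (i, j, k) \<in> H}" for x y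
      using that d by fastforce
    show "m3 - m3' \<in> {k. \<exists>i j. (i, j, k) \<in> H}" "m3 - m3' \<noteq> 0" using m3 by auto
  qed auto
  obtain r0 where r0: "(r0, b, 0) \<in> H" using b(2)[of b] by auto
  define r where "r = r0 mod a"
  have r: "(r, b, 0) \<in> H"
    using d1[OF r0, of "a * (r0 div a)" 0] a(2) by (simp add: r_def minus_mult_div_eq_mod)
  obtain u0 v0 where uv0: "(u0, v0, l) \<in> H" using l(2)[of l] by auto
  have bm: "(n * r, n * b, 0) \<in> H" for n
  proof -
    have "n \<in> {n. (n * r, n * b, 0) \<in> H}"
    proof (rule int_diff_closed_eq_UNIV)
      show "1 \<in> {n. (n * r, n * b, 0) \<in> H}" using r by simp
      show "x - y \<in> {n. (n * r, n * b, 0) \<in> H}"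
        if "x \<in> {n. (n * r, n * b, 0) \<in> H}" "y \<in> {n. (n * r, n * b, 0) \<in> H}" for x y
        using that d1[of "x * r" "x * b" "y * r" "y * b"] by (simp add: left_diff_distrib)
    qed
    then show ?thesis by simp
  qed
  \<comment> \<open>Replacing \<open>v0\<close> by its remainder subtracts \<open>v0 div b\<close>
    times \<open>(r, b, 0)\<close>, which also moves the first coordinate, to \<open>u1\<close>;
    only then is that coordinate reduced modulo \<open>a\<close>.\<close>
  define v where "v = v0 mod b"
  define u1 where "u1 = u0 - v0 div b * r"
  define u where "u = u1 mod a"
  have "(- (v0 div b * r) , - (v0 div b * b), 0) \<otimes>\<^bsub>semi e\<^esub> (u0, v0, l) \<in> H"
    using m[OF bm[of "- (v0 div b)"] uv0] by simp
  then have "(u1, v, l) \<in> H" by (simp add: u1_def v_def minus_div_mult_eq_mod[symmetric])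
  moreover have "(- (u1 div a * a), 0, 0) \<in> H" using a(2) by simp
  ultimately have "(- (u1 div a * a), 0, 0) \<otimes>\<^bsub>semi e\<^esub> (u1, v, l) \<in> H" by (rule m[rotated])
  then have uv: "(u, v, l) \<in> H" by (simp add: u_def minus_div_mult_eq_mod[symmetric])
  define \<phi> where "\<phi> = semi_emb e a b l r u v"
  define e' where "e' \<longleftrightarrow> e \<and> odd l"
  interpret \<phi>: group_hom "semi e'" "semi e" \<phi>
    using group_semi semi_emb_hom by (simp add: group_hom_def group_hom_axioms_def \<phi>_def e'_def)
  have acc: "acc x 0 = 0" "acc x 1 = 1" for x by (simp_all add: acc_def)
  have sub: "subgroup {t. \<phi> t \<in> H} (semi e')"
    using \<phi>.subgroup_preimage[OF H] by simp
  have \<phi>H: "\<phi> t \<in> H" for t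
    using semi_generated[OF sub] a r uv by (simp add: \<phi>_def acc)
  have "H \<subseteq> range \<phi>"
  proof
    fix t assume t: "t \<in> H"
    obtain i j k where ijk: "t = (i, j, k)" by (cases t)
    obtain k1 where k1: "k = l * k1" using l(2)[of k] t ijk by (auto simp: dvd_def)
    \<comment> \<open>Dividing \<open>t\<close> by the image of \<open>(0, 0, k1)\<close> brings it
      to third coordinate 0, where the lattice basis applies.\<close>
    define c where "c = acc e' k1"
    have "t \<otimes>\<^bsub>semi e\<^esub> inv\<^bsub>semi e\<^esub> (\<phi> (0, 0, k1)) \<in> H" by (rule d[OF t \<phi>H])
    then have 1: "(i - c * u, j - c * v, 0) \<in> H"
      by (simp add: ijk \<phi>_def k1 c_def e'_def mult.commute)
    then obtain j1 where j1: "j - c * v = b * j1" using b(2)[of "j - c * v"] by (auto simp: dvd_def)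
    have "(i - c * u - j1 * r, 0, 0) \<in> H" using d1[OF 1 bm[of j1]] j1 by (simp add: mult.commute)
    then obtain i1 where "i - c * u - j1 * r = a * i1" using a(2) by (auto simp: dvd_def)
    then have "t = \<phi> (i1, j1, k1)" using j1 k1 by (simp add: ijk \<phi>_def c_def e'_def algebra_simps)
    then show "t \<in> range \<phi>" by blast
  qed
  with \<phi>H have "H = range \<phi>" by blast
  then show ?thesis
    using that[of a b l r u v] a(1) b(1) l(1) by (simp add: \<phi>_def r_def u_def v_def)
qed

text \<open>Membership tests at special points, from which the parameters can be read off one by
  one; they yield uniqueness in \<open>semi_emb_range_inj\<close>.\<close>

lemma semi_emb_range_mem:
  assumes pos: "a > 0" "b > 0" "l > 0"
  shows "(i, 0, 0) \<in> range (semi_emb e a b l r u v) \<longleftrightarrow> a dvd i"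
    and "(i, b, 0) \<in> range (semi_emb e a b l r u v) \<longleftrightarrow> a dvd i - r"
    and "(i, j, l) \<in> range (semi_emb e a b l r u v) \<longleftrightarrow>
      (\<exists>j'. j = j' * b + v \<and> a dvd i - j' * r - u)"
    and "(\<exists>i. (i, j, 0) \<in> range (semi_emb e a b l r u v)) \<longleftrightarrow> b dvd j"
    and "(\<exists>i j. (i, j, k) \<in> range (semi_emb e a b l r u v)) \<longleftrightarrow> l dvd k"
proof -
  have acc: "acc x 0 = 0" "acc x 1 = 1" for x by (simp_all add: acc_def)
  have mem: "(i, j, k) \<in> range (semi_emb e a b l r u v) \<longleftrightarrow> (\<exists>i1 j1 k1.
      i = i1 * a + j1 * r + acc (e \<and> odd l) k1 * u \<and> j = j1 * b + acc (e \<and> odd l) k1 * v \<and>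
      k = k1 * l)" for i j k
    by (simp add: image_iff split_paired_Ex)
  have mem0: "(i, j, 0) \<in> range (semi_emb e a b l r u v) \<longleftrightarrow> (\<exists>i1 j1. i = i1 * a + j1 * r \<and> j = j1 * b)"
    for i j
    using pos unfolding mem by (simp add: acc ex_simps(1)[symmetric] cong: conj_cong)
  have meml: "(i, j, l) \<in> range (semi_emb e a b l r u v) \<longleftrightarrow>
      (\<exists>i1 j1. i = i1 * a + j1 * r + u \<and> j = j1 * b + v)" for i j
  proof -
    have "l = k1 * l \<longleftrightarrow> k1 = 1" for k1 using pos by auto
    then show ?thesis unfolding mem by (simp add: acc cong: conj_cong)
  qed
  show "(i, 0, 0) \<in> range (semi_emb e a b l r u v) \<longleftrightarrow> a dvd i"
    unfolding mem0 using pos by (auto simp: dvd_def mult.commute)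
  have "b = j1 * b \<longleftrightarrow> j1 = 1" for j1 using pos by auto
  then show "(i, b, 0) \<in> range (semi_emb e a b l r u v) \<longleftrightarrow> a dvd i - r"
    unfolding mem0 by (simp add: dvd_def) (metis add_diff_cancel_right' diff_add_cancel mult.commute)
  show "(i, j, l) \<in> range (semi_emb e a b l r u v) \<longleftrightarrow>
      (\<exists>j'. j = j' * b + v \<and> a dvd i - j' * r - u)"
  proof -
    have "a dvd i - j' * r - u \<longleftrightarrow> (\<exists>i1. i = i1 * a + j' * r + u)" for j'
      unfolding dvd_def by (auto simp: algebra_simps)
    then show ?thesis unfolding meml by blast
  qed
  show "(\<exists>i. (i, j, 0) \<in> range (semi_emb e a b l r u v)) \<longleftrightarrow> b dvd j"
    unfolding mem0 by (auto simp: dvd_def mult.commute)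
  show "(\<exists>i j. (i, j, k) \<in> range (semi_emb e a b l r u v)) \<longleftrightarrow> l dvd k"
    unfolding mem by (auto simp: dvd_def mult.commute)
qed

lemma semi_emb_range_inj:
  assumes eq: "range (semi_emb e a b l r u v) = range (semi_emb e a' b' l' r' u' v')"
    and pos: "a > 0" "b > 0" "l > 0" "a' > 0" "b' > 0" "l' > 0"
    and bounds: "0 \<le> r" "r < a" "0 \<le> u" "u < a" "0 \<le> v" "v < b"
      "0 \<le> r'" "r' < a'" "0 \<le> u'" "u' < a'" "0 \<le> v'" "v' < b'"
  shows "a = a' \<and> b = b' \<and> l = l' \<and> r = r' \<and> u = u' \<and> v = v'"
proof -
  let ?E = "range (semi_emb e a b l r u v)"
  note m = semi_emb_range_mem[OF pos(1-3), where e = e and r = r and u = u and v = v]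
  note m' = semi_emb_range_mem[OF pos(4-6), where e = e and r = r' and u = u' and v = v', folded eq]
  have a: "a = a'" using m(1) m'(1) by (intro int_eq_if_dvd_iff pos) metis
  have b: "b = b'" using m(4) m'(4) by (intro int_eq_if_dvd_iff pos) metis
  have l: "l = l'" using m(5) m'(5) by (intro int_eq_if_dvd_iff pos) metis
  have "(r, b, 0) \<in> ?E" using m(2) by simp
  then have "a dvd r - r'" using m'(2) a b by simp
  then have r: "r = r'" using bounds a by (intro int_eq_if_dvd_diff) auto
  have "(u, v, l) \<in> ?E" using m(3)[of u v] by (auto intro!: exI[of _ 0])
  then obtain j where j: "v = j * b + v'" "a dvd u - j * r' - u'" using m'(3)[of u v] a b l by auto
  then have "b dvd v - v'" by simp
  then have v: "v = v'" using bounds b by (intro int_eq_if_dvd_diff) auto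
  with j pos have "a dvd u - u'" by simp
  then have u: "u = u'" using bounds a by (intro int_eq_if_dvd_diff) auto
  show ?thesis using a b l r u v by simp
qed

text \<open>Each triple \<open>(a, b, l)\<close> admits \<open>a\<close> values of \<open>r\<close>,
  \<open>a\<close> of \<open>u\<close> and \<open>b\<close> of \<open>v\<close>, whence the weight
  in \<open>omega\<close>. The index is a rational \<open>q\<close> because it will be n/4 or n/2;
  for a non-integer both sides are 0.\<close>

lemma semi_subgroups_card:
  assumes q: "q > 0"
  shows "finite {H. subgroup H (semi e) \<and> of_nat (card (rcosets\<^bsub>semi e\<^esub> H)) = q}" (is "finite ?S")
    and "int (card {H. subgroup H (semi e) \<and> of_nat (card (rcosets\<^bsub>semi e\<^esub> H)) = q}) = omega q"
proof -
  define B where "B = (\<lambda>(a, b, l :: nat). {0..<int a} \<times> {0..<int a} \<times> {0..<int b})"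
  define F where "F = (\<lambda>((a, b, l), (r, u, v)). range (semi_emb e (int a) (int b) (int l) r u v))"
  have "bij_betw F (Sigma (factor_triples q) B) ?S"
  proof (rule bij_betw_imageI)
    show "inj_on F (Sigma (factor_triples q) B)"
    proof (rule inj_onI)
      fix s t assume s: "s \<in> Sigma (factor_triples q) B" and t: "t \<in> Sigma (factor_triples q) B"
        and eq: "F s = F t"
      obtain a b l r u v a' b' l' r' u' v'
        where st: "s = ((a, b, l), (r, u, v))" "t = ((a', b', l'), (r', u', v'))"
        by (cases s; cases t) auto
      show "s = t"
        using semi_emb_range_inj[of e "int a" "int b" "int l" r u v "int a'" "int b'" "int l'" r' u' v']
          s t eq by (simp add: st F_def B_def factor_triples_def)
    qed
    show "F ` Sigma (factor_triples q) B = ?S"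
    proof
      show "F ` Sigma (factor_triples q) B \<subseteq> ?S"
        using card_rcosets_semi_emb
        by (auto simp: F_def factor_triples_def subgroup_range_semi_emb)
      show "?S \<subseteq> F ` Sigma (factor_triples q) B"
      proof
        fix H assume "H \<in> ?S"
        then have H: "subgroup H (semi e)" and c: "of_nat (card (rcosets\<^bsub>semi e\<^esub> H)) = q" by auto
        then have "finite (rcosets\<^bsub>semi e\<^esub> H)" using q card.infinite by fastforce
        then obtain a b l r u v where pos: "a > 0" "b > 0" "l > 0"
          and bd: "0 \<le> r" "r < a" "0 \<le> u" "u < a" "0 \<le> v" "v < b"
          and HE: "H = range (semi_emb e a b l r u v)"
          by (rule semi_finite_index_subgroup[OF H])
        have "((nat a, nat b, nat l), (r, u, v)) \<in> Sigma (factor_triples q) B"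
          using c card_rcosets_semi_emb[OF pos, of e r u v] pos bd
          by (simp add: HE B_def factor_triples_def)
        moreover have "H = F ((nat a, nat b, nat l), (r, u, v))" using pos by (simp add: HE F_def)
        ultimately show "H \<in> F ` Sigma (factor_triples q) B" by blast
      qed
    qed
  qed
  moreover have fin: "finite (B t)" for t by (cases t) (simp add: B_def)
  moreover have "int (card (Sigma (factor_triples q) B)) = omega q"
    by (simp add: card_SigmaI finite_factor_triples fin omega_def)
      (auto intro!: sum.cong simp: B_def power2_eq_square)
  ultimately show "finite ?S" "int (card ?S) = omega q"
    using bij_betw_finite[of F "Sigma (factor_triples q) B" ?S]
      bij_betw_same_card[of F "Sigma (factor_triples q) B" ?S]
    by (auto simp: finite_SigmaI[OF finite_factor_triples])
qed

section \<open>Coordinates for Z^3 and for the presentation of the group of G2\<close>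

lemma pi1_G1_eq: "pi1_G1 = semi False"
  by (simp add: pi1_G1_def semi_def DirProd_def integer_group_def fun_eq_iff split: prod.split)

definition semi_gen :: "gen \<Rightarrow> int \<times> int \<times> int" where
  "semi_gen = case_gen (1, 0, 0) (0, 1, 0) (0, 0, 1)"

lemma pi1_G2_iso: "pi1_G2 \<cong> semi True"
proof -
  define R where "R = {(wx @ wy @ word_inv wx @ word_inv wy, []),
     (word_conj wx wz, word_inv wx), (word_conj wy wz, word_inv wy)}"
  define P where "P = presented_group R"
  interpret P: group P unfolding P_def by (rule group_presented_group)
  define c where "c = (\<lambda>g. pres_class R [(g, True)])"
  define x y z where xyz: "x = c GenX" "y = c GenY" "z = c GenZ"
  have car: "x \<in> carrier P" "y \<in> carrier P" "z \<in> carrier P"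
    by (simp_all add: xyz c_def P_def presented_group_def)
  have rel: "word_eval P c l = word_eval P c r" if "(l, r) \<in> R" for l r
    unfolding P_def c_def by (rule presented_group_rel[OF that])
  have xy: "x \<otimes>\<^bsub>P\<^esub> y = y \<otimes>\<^bsub>P\<^esub> x"
    using rel[of "wx @ wy @ word_inv wx @ word_inv wy" "[]"] car
    by (simp add: R_def word_inv_def xyz[symmetric] P.m_assoc[symmetric] P.inv_solve_right')
  have zx: "z \<otimes>\<^bsub>P\<^esub> x = inv\<^bsub>P\<^esub> x \<otimes>\<^bsub>P\<^esub> z" and zy: "z \<otimes>\<^bsub>P\<^esub> y = inv\<^bsub>P\<^esub> y \<otimes>\<^bsub>P\<^esub> z"
    using rel[of "word_conj wx wz" "word_inv wx"] rel[of "word_conj wy wz" "word_inv wy"] car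
    by (simp_all add: R_def word_conj_def word_inv_def xyz[symmetric] P.m_assoc[symmetric]
        P.inv_solve_right')
  \<comment> \<open>The normal form required by \<open>presented_group_iso\<close>. A generator x
    multiplied from the right has to pass z^k, which contributes the sign \<open>s\<close>, and y^j,
    with which it commutes.\<close>
  define N where "N = (\<lambda>(i, j, k). x [^]\<^bsub>P\<^esub> (i :: int) \<otimes>\<^bsub>P\<^esub> (y [^]\<^bsub>P\<^esub> (j :: int) \<otimes>\<^bsub>P\<^esub> z [^]\<^bsub>P\<^esub> (k :: int)))"
  have "P \<cong> semi True"
    unfolding P_def
  proof (rule group.presented_group_iso[OF group_semi, where h = semi_gen and N = N])
    show "word_eval (semi True) semi_gen l = word_eval (semi True) semi_gen r" if "(l, r) \<in> R" for l r
      using that by (auto simp: R_def word_inv_def word_conj_def semi_gen_def twist_def)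
    show "carrier (semi True) \<subseteq> J" if J: "subgroup J (semi True)" "range semi_gen \<subseteq> J" for J
    proof -
      have "semi_gen g \<in> J" for g using J(2) by blast
      from this[of GenX] this[of GenY] this[of GenZ] show ?thesis
        using semi_generated[OF J(1)] by (auto simp: semi_gen_def)
    qed
    show "N \<one>\<^bsub>semi True\<^esub> = \<one>\<^bsub>presented_group R\<^esub>"
      by (simp add: N_def P_def[symmetric])
    show "N t \<in> carrier (presented_group R)" for t
      using car by (cases t) (simp add: N_def P_def[symmetric])
    fix t :: "int \<times> int \<times> int" and g
    obtain i j k where t: "t = (i, j, k)" by (cases t)
    define s where "s = twist True k"
    have "N (t \<otimes>\<^bsub>semi True\<^esub> semi_gen g) = N t \<otimes>\<^bsub>P\<^esub> c g"
    proof (cases g)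
      case GenX
      have "y [^]\<^bsub>P\<^esub> j \<otimes>\<^bsub>P\<^esub> (z [^]\<^bsub>P\<^esub> k \<otimes>\<^bsub>P\<^esub> x) = x [^]\<^bsub>P\<^esub> s \<otimes>\<^bsub>P\<^esub> (y [^]\<^bsub>P\<^esub> j \<otimes>\<^bsub>P\<^esub> z [^]\<^bsub>P\<^esub> k)"
        using P.int_pow_twist[OF car(1,3) zx, of k] P.int_pows_commute[OF car(1,2) xy, of s j] car
        by (simp add: s_def P.m_assoc[symmetric])
      then show ?thesis
        using car by (simp add: GenX t N_def semi_gen_def xyz(1)[symmetric] s_def[symmetric]
            P.int_pow_mult P.m_assoc)
    next
      case GenY
      have "z [^]\<^bsub>P\<^esub> k \<otimes>\<^bsub>P\<^esub> y = y [^]\<^bsub>P\<^esub> s \<otimes>\<^bsub>P\<^esub> z [^]\<^bsub>P\<^esub> k"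
        unfolding s_def by (rule P.int_pow_twist[OF car(2,3) zy])
      then show ?thesis
        using car by (simp add: GenY t N_def semi_gen_def xyz(2)[symmetric] s_def[symmetric]
            P.int_pow_mult P.m_assoc)
    next
      case GenZ
      then show ?thesis
        using car by (simp add: t N_def semi_gen_def xyz(3)[symmetric] P.int_pow_mult P.m_assoc)
    qed
    then show "N (t \<otimes>\<^bsub>semi True\<^esub> semi_gen g) = N t \<otimes>\<^bsub>presented_group R\<^esub> pres_class R [(g, True)]"
      by (simp add: c_def P_def)
  qed simp
  then show ?thesis by (simp add: pi1_G2_def R_def P_def)
qed

section \<open>The Hantzsche--Wendt group\<close>

text \<open>The group generated by the isometries \<open>(p, q, r) \<mapsto> (p + 1, 1 - q, - r)\<close>,
  \<open>(- p, q + 1, 1 - r)\<close> and \<open>(1 - p, - q, r + 1)\<close> of \<open>\<real>\<^sup>3\<close> acts simply transitively on the integer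
  points with even coordinate sum; an element is identified with its image of the origin.\<close>

abbreviation par :: "int \<Rightarrow> int" where "par \<equiv> twist True"

lemma par_par [simp]: "par (par a) = - 1"
  by (simp add: twist_def)

lemma even_par [simp]: "even (par c) \<longleftrightarrow> False"
  by (simp add: twist_def)

lemma par_even [simp]: "even a \<Longrightarrow> par a = 1" and par_odd: "odd a \<Longrightarrow> par a = - 1"
  by (simp_all add: twist_def)

definition hw :: "(int \<times> int \<times> int) monoid" where
  "hw = \<lparr>carrier = {(a, b, c). even (a + b + c)},
    monoid.mult = (\<lambda>(a, b, c) (a', b', c'). (a + par c * a', b + par a * b', c + par b * c')),
    one = (0, 0, 0)\<rparr>"

lemma hw_simps [simp]:
  "(a, b, c) \<in> carrier hw \<longleftrightarrow> even (a + b + c)" "\<one>\<^bsub>hw\<^esub> = (0, 0, 0)"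
  "(a, b, c) \<otimes>\<^bsub>hw\<^esub> (a', b', c') = (a + par c * a', b + par a * b', c + par b * c')"
  by (simp_all add: hw_def)

lemma group_hw: "group hw"
proof (rule groupI)
  fix t assume "t \<in> carrier hw"
  then obtain a b c where "t = (a, b, c)" "even (a + b + c)" by (cases t) simp
  then have "(- par c * a, - par a * b, - par b * c) \<otimes>\<^bsub>hw\<^esub> t = \<one>\<^bsub>hw\<^esub>"
    and "(- par c * a, - par a * b, - par b * c) \<in> carrier hw"
    by (simp, auto)
  then show "\<exists>s\<in>carrier hw. s \<otimes>\<^bsub>hw\<^esub> t = \<one>\<^bsub>hw\<^esub>" by blast
next
  fix s t u assume "s \<in> carrier hw" "t \<in> carrier hw" "u \<in> carrier hw"
  show "s \<otimes>\<^bsub>hw\<^esub> t \<otimes>\<^bsub>hw\<^esub> u = s \<otimes>\<^bsub>hw\<^esub> (t \<otimes>\<^bsub>hw\<^esub> u)"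
    by (cases s; cases t; cases u) (simp add: distrib_left mult.assoc add.assoc)
  show "s \<otimes>\<^bsub>hw\<^esub> t \<in> carrier hw"
    using \<open>s \<in> carrier hw\<close> \<open>t \<in> carrier hw\<close> by (cases s; cases t) auto
next
  fix t assume "t \<in> carrier hw"
  then show "\<one>\<^bsub>hw\<^esub> \<otimes>\<^bsub>hw\<^esub> t = t" by (cases t) simp
qed simp

lemma inv_hw [simp]:
  "even (a + b + c) \<Longrightarrow> inv\<^bsub>hw\<^esub> (a, b, c) = (- par c * a, - par a * b, - par b * c)"
  by (rule group.inv_equality[OF group_hw]) auto

text \<open>An even sum leaves four parity patterns: the cosets of the translations with
  representatives 1, x, y, z, in this order.\<close>

lemma hw_parity_cases:
  assumes "t \<in> carrier hw"
  obtains i j k where "t = (2 * i, 2 * j, 2 * k)"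
  | i j k where "t = (2 * i + 1, 2 * j + 1, 2 * k)"
  | i j k where "t = (2 * i, 2 * j + 1, 2 * k + 1)"
  | i j k where "t = (2 * i + 1, 2 * j, 2 * k + 1)"
proof -
  obtain a b c where t: "t = (a, b, c)" "even (a + b + c)" using assms by (cases t) simp
  show ?thesis
  proof (cases "even a"; cases "even b")
    assume "even a" "even b"
    then show ?thesis using that(1)[of "a div 2" "b div 2" "c div 2"] t by simp
  next
    assume "odd a" "odd b"
    then show ?thesis using that(2)[of "a div 2" "b div 2" "c div 2"] t by simp
  next
    assume "even a" "odd b"
    then show ?thesis using that(3)[of "a div 2" "b div 2" "c div 2"] t by simp
  next
    assume "odd a" "even b"
    then show ?thesis using that(4)[of "a div 2" "b div 2" "c div 2"] t by simp
  qed
qed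

lemma even_points_subgroup:
  assumes J: "subgroup J hw" and "(2 * d, 0, 0) \<in> J" "(0, 2 * d', 0) \<in> J" "(0, 0, 2 * d'') \<in> J"
  shows "(2 * d * i, 2 * d' * j, 2 * d'' * k) \<in> J"
proof -
  note m = subgroup.m_closed[OF J] and d = subgroup.m_closed[OF J _ subgroup.m_inv_closed[OF J]]
  have 1: "(2 * d * i, 0, 0) \<in> J" for i
    using int_diff_closed_eq_UNIV[of "{i. (2 * d * i, 0, 0) \<in> J}" i] assms
      d[of "(2 * d * _, 0, 0)" "(2 * d * _, 0, 0)"] by (simp add: right_diff_distrib)
  have 2: "(0, 2 * d' * j, 0) \<in> J" for j
    using int_diff_closed_eq_UNIV[of "{i. (0, 2 * d' * i, 0) \<in> J}" j] assms
      d[of "(0, 2 * d' * _, 0)" "(0, 2 * d' * _, 0)"] by (simp add: right_diff_distrib)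
  have 3: "(0, 0, 2 * d'' * k) \<in> J" for k
    using int_diff_closed_eq_UNIV[of "{i. (0, 0, 2 * d'' * i) \<in> J}" k] assms
      d[of "(0, 0, 2 * d'' * _)" "(0, 0, 2 * d'' * _)"] by (simp add: right_diff_distrib)
  show ?thesis using m[OF m[OF 1[of i] 2[of j]] 3[of k]] by simp
qed

text \<open>The inverse of the product of the two generators is \<open>(1, 0, 1)\<close>, the
  squares of all three are the translations by 2 along the axes, and one more factor reaches the
  remaining cosets.\<close>

lemma hw_generated:
  assumes J: "subgroup J hw" and x: "(1, 1, 0) \<in> J" and y: "(0, 1, 1) \<in> J"
    and t: "t \<in> carrier hw"
  shows "t \<in> J"
proof -
  note m = subgroup.m_closed[OF J]
  have xy: "(1, 0, - 1) \<in> J" using m[OF x y] by (simp add: par_odd)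
  have z: "(1, 0, 1) \<in> J" using subgroup.m_inv_closed[OF J xy] by (simp add: par_odd)
  have even: "(2 * i, 2 * j, 2 * k) \<in> J" for i j k
    using even_points_subgroup[OF J, of 1 1 1 i j k] m[OF x x] m[OF y y] m[OF z z]
    by (simp add: par_odd)
  show ?thesis
    using t
  proof (cases rule: hw_parity_cases)
    case (1 i j k)
    then show ?thesis using even by simp
  next
    case (2 i j k)
    then show ?thesis using m[OF even x, of i j k] by simp
  next
    case (3 i j k)
    then show ?thesis using m[OF even y, of i j k] by simp
  next
    case (4 i j k)
    then show ?thesis using m[OF even z, of i j k] by simp
  qed
qed

section \<open>The presentation of the group of G6\<close>

definition hw_gen :: "gen \<Rightarrow> int \<times> int \<times> int" where
  "hw_gen = case_gen (1, 1, 0) (0, 1, 1) (1, 0, 1)"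

text \<open>The relations say that x inverts y^2 and y inverts x^2; z is the inverse of xy and
  therefore inverts both. Hence the three squares commute, and a product of their powers times one
  of 1, x, y, z serves as normal form.\<close>

lemma pi1_G6_iso: "pi1_G6 \<cong> hw"
proof -
  define R :: "(gen word \<times> gen word) set" where "R = {(wx @ wy @ wy @ word_inv wx @ wy @ wy, []),
     (wy @ wx @ wx @ word_inv wy @ wx @ wx, []), (wx @ wy @ wz, [])}"
  define P where "P = presented_group R"
  interpret P: group P unfolding P_def by (rule group_presented_group)
  define c where "c = (\<lambda>g. pres_class R [(g, True)])"
  define x y z where xyz: "x = c GenX" "y = c GenY" "z = c GenZ"
  have car: "x \<in> carrier P" "y \<in> carrier P" "z \<in> carrier P"
    by (simp_all add: xyz c_def P_def presented_group_def)
  have rel: "word_eval P c l = word_eval P c r" if "(l, r) \<in> R" for l r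
    unfolding P_def c_def by (rule presented_group_rel[OF that])
  define x2 where "x2 = x \<otimes>\<^bsub>P\<^esub> x"
  define y2 where "y2 = y \<otimes>\<^bsub>P\<^esub> y"
  define z2 where "z2 = z \<otimes>\<^bsub>P\<^esub> z"
  have carX: "x2 \<in> carrier P" "y2 \<in> carrier P" "z2 \<in> carrier P"
    using car by (simp_all add: x2_def y2_def z2_def)
  have r1: "x \<otimes>\<^bsub>P\<^esub> y2 \<otimes>\<^bsub>P\<^esub> inv\<^bsub>P\<^esub> x \<otimes>\<^bsub>P\<^esub> y2 = \<one>\<^bsub>P\<^esub>"
    using rel[of "wx @ wy @ wy @ word_inv wx @ wy @ wy" "[]"] car
    by (simp add: R_def word_inv_def xyz[symmetric] y2_def P.m_assoc)
  have r2: "y \<otimes>\<^bsub>P\<^esub> x2 \<otimes>\<^bsub>P\<^esub> inv\<^bsub>P\<^esub> y \<otimes>\<^bsub>P\<^esub> x2 = \<one>\<^bsub>P\<^esub>"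
    using rel[of "wy @ wx @ wx @ word_inv wy @ wx @ wx" "[]"] car
    by (simp add: R_def word_inv_def xyz[symmetric] x2_def P.m_assoc)
  have r3: "x \<otimes>\<^bsub>P\<^esub> y \<otimes>\<^bsub>P\<^esub> z = \<one>\<^bsub>P\<^esub>"
    using rel[of "wx @ wy @ wz" "[]"] car by (simp add: R_def xyz[symmetric] P.m_assoc)
  have z: "z = inv\<^bsub>P\<^esub> (x \<otimes>\<^bsub>P\<^esub> y)"
    using P.inv_equality[of z "x \<otimes>\<^bsub>P\<^esub> y"] P.inv_comm[OF r3] car by simp
  have xY: "x \<otimes>\<^bsub>P\<^esub> y2 = inv\<^bsub>P\<^esub> y2 \<otimes>\<^bsub>P\<^esub> x"
    using P.inv_equality[OF r1] car carX by (simp add: P.m_assoc)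
  have yX: "y \<otimes>\<^bsub>P\<^esub> x2 = inv\<^bsub>P\<^esub> x2 \<otimes>\<^bsub>P\<^esub> y"
    using P.inv_equality[OF r2] car carX by (simp add: P.m_assoc)
  have XY: "x2 \<otimes>\<^bsub>P\<^esub> y2 = y2 \<otimes>\<^bsub>P\<^esub> x2"
    using P.inverting_facts(2)[OF carX(2) car(1) xY] by (simp add: x2_def)
  have "x \<otimes>\<^bsub>P\<^esub> y \<otimes>\<^bsub>P\<^esub> x2 = inv\<^bsub>P\<^esub> x2 \<otimes>\<^bsub>P\<^esub> (x \<otimes>\<^bsub>P\<^esub> y)"
  proof -
    have "x \<otimes>\<^bsub>P\<^esub> inv\<^bsub>P\<^esub> x2 = inv\<^bsub>P\<^esub> x2 \<otimes>\<^bsub>P\<^esub> x"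
      using car by (simp add: x2_def P.inv_mult_group P.m_assoc P.cancel_inv_assoc)
    then show ?thesis using car carX yX by (metis P.inv_closed P.m_assoc)
  qed
  \<comment> \<open>The inverse of an element that inverts \<open>x2\<close> inverts it as well;
    this passes from xy to z.\<close>
  then have zX: "z \<otimes>\<^bsub>P\<^esub> x2 = inv\<^bsub>P\<^esub> x2 \<otimes>\<^bsub>P\<^esub> z"
    unfolding z using car carX by (intro P.inverting_facts(3)) auto
  have "x \<otimes>\<^bsub>P\<^esub> y \<otimes>\<^bsub>P\<^esub> y2 = inv\<^bsub>P\<^esub> y2 \<otimes>\<^bsub>P\<^esub> (x \<otimes>\<^bsub>P\<^esub> y)"
  proof -
    have "y \<otimes>\<^bsub>P\<^esub> y2 = y2 \<otimes>\<^bsub>P\<^esub> y" using car by (simp add: y2_def P.m_assoc P.cancel_inv_assoc)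
    then show ?thesis using car carX xY by (metis P.inv_closed P.m_assoc P.cancel_inv_assoc)
  qed
  then have zY: "z \<otimes>\<^bsub>P\<^esub> y2 = inv\<^bsub>P\<^esub> y2 \<otimes>\<^bsub>P\<^esub> z"
    unfolding z using car carX by (intro P.inverting_facts(3)) auto
  have ZX: "z2 \<otimes>\<^bsub>P\<^esub> x2 = x2 \<otimes>\<^bsub>P\<^esub> z2" and ZY: "z2 \<otimes>\<^bsub>P\<^esub> y2 = y2 \<otimes>\<^bsub>P\<^esub> z2"
    using P.inverting_facts(2)[OF carX(1) car(3) zX] P.inverting_facts(2)[OF carX(2) car(3) zY]
    by (simp_all add: z2_def)
  define T where "T = (\<lambda>i j k. x2 [^]\<^bsub>P\<^esub> (i :: int) \<otimes>\<^bsub>P\<^esub> y2 [^]\<^bsub>P\<^esub> (j :: int) \<otimes>\<^bsub>P\<^esub> z2 [^]\<^bsub>P\<^esub> (k :: int))"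
  have carT: "T i j k \<in> carrier P" for i j k using carX by (simp add: T_def)
  have T_add: "T (i + i') (j + j') (k + k') = T i j k \<otimes>\<^bsub>P\<^esub> T i' j' k'" for i j k i' j' k'
  proof -
    have "z2 [^]\<^bsub>P\<^esub> k \<otimes>\<^bsub>P\<^esub> (x2 [^]\<^bsub>P\<^esub> i' \<otimes>\<^bsub>P\<^esub> w) = x2 [^]\<^bsub>P\<^esub> i' \<otimes>\<^bsub>P\<^esub> (z2 [^]\<^bsub>P\<^esub> k \<otimes>\<^bsub>P\<^esub> w)"
      "z2 [^]\<^bsub>P\<^esub> k \<otimes>\<^bsub>P\<^esub> (y2 [^]\<^bsub>P\<^esub> j' \<otimes>\<^bsub>P\<^esub> w) = y2 [^]\<^bsub>P\<^esub> j' \<otimes>\<^bsub>P\<^esub> (z2 [^]\<^bsub>P\<^esub> k \<otimes>\<^bsub>P\<^esub> w)"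
      "y2 [^]\<^bsub>P\<^esub> j \<otimes>\<^bsub>P\<^esub> (x2 [^]\<^bsub>P\<^esub> i' \<otimes>\<^bsub>P\<^esub> w) = x2 [^]\<^bsub>P\<^esub> i' \<otimes>\<^bsub>P\<^esub> (y2 [^]\<^bsub>P\<^esub> j \<otimes>\<^bsub>P\<^esub> w)"
      if "w \<in> carrier P" for w
      using that carX P.int_pows_commute[OF carX(3,1) ZX, of k i']
        P.int_pows_commute[OF carX(3,2) ZY, of k j'] P.int_pows_commute[OF carX(1,2) XY, of i' j]
      by (simp_all add: P.m_assoc[symmetric])
    then show ?thesis using carX by (simp add: T_def P.int_pow_mult P.m_assoc P.cancel_inv_assoc)
  qed
  \<comment> \<open>Right multiplication of the coset representatives by x and y; the arguments of
    \<open>T\<close> are the carries that occur in the \<open>div 2\<close> coordinates of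
    \<open>hw\<close>.\<close>
  have table:
    "x \<otimes>\<^bsub>P\<^esub> x = T 1 0 0" "y \<otimes>\<^bsub>P\<^esub> x = T (- 1) 1 0 \<otimes>\<^bsub>P\<^esub> z" "z \<otimes>\<^bsub>P\<^esub> x = T 0 (- 1) 0 \<otimes>\<^bsub>P\<^esub> y"
    "x \<otimes>\<^bsub>P\<^esub> y = T 0 0 (- 1) \<otimes>\<^bsub>P\<^esub> z" "y \<otimes>\<^bsub>P\<^esub> y = T 0 1 0" "z \<otimes>\<^bsub>P\<^esub> y = T 0 (- 1) 1 \<otimes>\<^bsub>P\<^esub> x"
  proof -
    have z': "z = inv\<^bsub>P\<^esub> y \<otimes>\<^bsub>P\<^esub> inv\<^bsub>P\<^esub> x" using z car by (simp add: P.inv_mult_group)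
    show "x \<otimes>\<^bsub>P\<^esub> x = T 1 0 0" "y \<otimes>\<^bsub>P\<^esub> y = T 0 1 0" using carX by (simp_all add: T_def x2_def y2_def)
    have "x \<otimes>\<^bsub>P\<^esub> y = inv\<^bsub>P\<^esub> z" using car z by simp
    also have "\<dots> = inv\<^bsub>P\<^esub> z2 \<otimes>\<^bsub>P\<^esub> z" using car by (simp add: z2_def P.inv_mult_group P.m_assoc P.cancel_inv_assoc)
    finally show "x \<otimes>\<^bsub>P\<^esub> y = T 0 0 (- 1) \<otimes>\<^bsub>P\<^esub> z" using carX by (simp add: T_def P.int_pow_neg)
    have zx: "z \<otimes>\<^bsub>P\<^esub> x = inv\<^bsub>P\<^esub> y" using car by (simp add: z' P.m_assoc P.cancel_inv_assoc)
    also have "\<dots> = inv\<^bsub>P\<^esub> y2 \<otimes>\<^bsub>P\<^esub> y" using car by (simp add: y2_def P.inv_mult_group P.m_assoc P.cancel_inv_assoc)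
    finally show "z \<otimes>\<^bsub>P\<^esub> x = T 0 (- 1) 0 \<otimes>\<^bsub>P\<^esub> y" using carX by (simp add: T_def P.int_pow_neg)
    have "y \<otimes>\<^bsub>P\<^esub> x = y \<otimes>\<^bsub>P\<^esub> x2 \<otimes>\<^bsub>P\<^esub> inv\<^bsub>P\<^esub> x" using car by (simp add: x2_def P.m_assoc P.cancel_inv_assoc)
    also have "\<dots> = inv\<^bsub>P\<^esub> x2 \<otimes>\<^bsub>P\<^esub> (y2 \<otimes>\<^bsub>P\<^esub> z)"
      unfolding yX using car carX(1) by (simp add: z' y2_def P.m_assoc P.cancel_inv_assoc)
    finally show "y \<otimes>\<^bsub>P\<^esub> x = T (- 1) 1 0 \<otimes>\<^bsub>P\<^esub> z"
      using carX car by (simp add: T_def P.int_pow_neg P.m_assoc P.cancel_inv_assoc)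
    have "z \<otimes>\<^bsub>P\<^esub> y = z \<otimes>\<^bsub>P\<^esub> y2 \<otimes>\<^bsub>P\<^esub> inv\<^bsub>P\<^esub> y" using car by (simp add: y2_def P.m_assoc P.cancel_inv_assoc)
    also have "\<dots> = inv\<^bsub>P\<^esub> y2 \<otimes>\<^bsub>P\<^esub> (z2 \<otimes>\<^bsub>P\<^esub> x)"
      unfolding zY using car carX(2) by (simp add: zx[symmetric] z2_def P.m_assoc P.cancel_inv_assoc)
    finally show "z \<otimes>\<^bsub>P\<^esub> y = T 0 (- 1) 1 \<otimes>\<^bsub>P\<^esub> x"
      using carX car by (simp add: T_def P.int_pow_neg P.m_assoc P.cancel_inv_assoc)
  qed
  \<comment> \<open>\<open>div\<close> rounds down, so an odd coordinate is twice its
    \<open>div 2\<close> plus 1, also when negative. On the carrier the parities of \<open>a\<close>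
    and \<open>b\<close> determine that of \<open>c\<close>, and hence the coset.\<close>
  define N where "N = (\<lambda>(a, b, c :: int). T (a div 2) (b div 2) (c div 2) \<otimes>\<^bsub>P\<^esub>
      (if even a then if even b then \<one>\<^bsub>P\<^esub> else y else if even b then z else x))"
  have N: "N (2 * i, 2 * j, 2 * k) = T i j k" "N (2 * i + 1, 2 * j + 1, 2 * k) = T i j k \<otimes>\<^bsub>P\<^esub> x"
    "N (2 * i, 2 * j + 1, 2 * k + 1) = T i j k \<otimes>\<^bsub>P\<^esub> y"
    "N (2 * i + 1, 2 * j, 2 * k + 1) = T i j k \<otimes>\<^bsub>P\<^esub> z" for i j k
    using carT by (simp_all add: N_def)
  have N_x: "N (t \<otimes>\<^bsub>hw\<^esub> (1, 1, 0)) = N t \<otimes>\<^bsub>P\<^esub> x" if "t \<in> carrier hw" for t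
    using that
  proof (cases rule: hw_parity_cases)
    case (1 i j k)
    then show ?thesis by (simp add: N)
  next
    case (2 i j k)
    have eq: "t \<otimes>\<^bsub>hw\<^esub> (1, 1, 0) = (2 * (i + 1), 2 * j, 2 * k)"
      unfolding 2 by (simp add: par_odd)
    have "N (2 * (i + 1), 2 * j, 2 * k) = T i j k \<otimes>\<^bsub>P\<^esub> (x \<otimes>\<^bsub>P\<^esub> x)"
      unfolding N table using T_add[of i 1 j 0 k 0] by simp
    then show ?thesis unfolding eq by (simp only: 2 N P.m_assoc car carT)
  next
    case (3 i j k)
    have eq: "t \<otimes>\<^bsub>hw\<^esub> (1, 1, 0) = (2 * (i - 1) + 1, 2 * (j + 1), 2 * k + 1)"
      unfolding 3 by (simp add: par_odd)
    have "N (2 * (i - 1) + 1, 2 * (j + 1), 2 * k + 1) = T i j k \<otimes>\<^bsub>P\<^esub> (y \<otimes>\<^bsub>P\<^esub> x)"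
      unfolding N table using T_add[of i "- 1" j 1 k 0] car carT by (simp add: P.m_assoc)
    then show ?thesis unfolding eq by (simp only: 3 N P.m_assoc car carT)
  next
    case (4 i j k)
    have eq: "t \<otimes>\<^bsub>hw\<^esub> (1, 1, 0) = (2 * i, 2 * (j - 1) + 1, 2 * k + 1)"
      unfolding 4 by (simp add: par_odd)
    have "N (2 * i, 2 * (j - 1) + 1, 2 * k + 1) = T i j k \<otimes>\<^bsub>P\<^esub> (z \<otimes>\<^bsub>P\<^esub> x)"
      unfolding N table using T_add[of i 0 j "- 1" k 0] car carT by (simp add: P.m_assoc)
    then show ?thesis unfolding eq by (simp only: 4 N P.m_assoc car carT)
  qed
  have N_y: "N (t \<otimes>\<^bsub>hw\<^esub> (0, 1, 1)) = N t \<otimes>\<^bsub>P\<^esub> y" if "t \<in> carrier hw" for t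
    using that
  proof (cases rule: hw_parity_cases)
    case (1 i j k)
    then show ?thesis by (simp add: N)
  next
    case (2 i j k)
    have eq: "t \<otimes>\<^bsub>hw\<^esub> (0, 1, 1) = (2 * i + 1, 2 * j, 2 * (k - 1) + 1)"
      unfolding 2 by (simp add: par_odd)
    have "N (2 * i + 1, 2 * j, 2 * (k - 1) + 1) = T i j k \<otimes>\<^bsub>P\<^esub> (x \<otimes>\<^bsub>P\<^esub> y)"
      unfolding N table using T_add[of i 0 j 0 k "- 1"] car carT by (simp add: P.m_assoc)
    then show ?thesis unfolding eq by (simp only: 2 N P.m_assoc car carT)
  next
    case (3 i j k)
    have eq: "t \<otimes>\<^bsub>hw\<^esub> (0, 1, 1) = (2 * i, 2 * (j + 1), 2 * k)"
      unfolding 3 by (simp add: par_odd)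
    have "N (2 * i, 2 * (j + 1), 2 * k) = T i j k \<otimes>\<^bsub>P\<^esub> (y \<otimes>\<^bsub>P\<^esub> y)"
      unfolding N table using T_add[of i 0 j 1 k 0] car carT by (simp add: P.m_assoc)
    then show ?thesis unfolding eq by (simp only: 3 N P.m_assoc car carT)
  next
    case (4 i j k)
    have eq: "t \<otimes>\<^bsub>hw\<^esub> (0, 1, 1) = (2 * i + 1, 2 * (j - 1) + 1, 2 * (k + 1))"
      unfolding 4 by (simp add: par_odd)
    have "N (2 * i + 1, 2 * (j - 1) + 1, 2 * (k + 1)) = T i j k \<otimes>\<^bsub>P\<^esub> (z \<otimes>\<^bsub>P\<^esub> y)"
      unfolding N table using T_add[of i 0 j "- 1" k 1] car carT by (simp add: P.m_assoc)
    then show ?thesis unfolding eq by (simp only: 4 N P.m_assoc car carT)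
  qed
  have carN: "N t \<in> carrier P" for t
    using car carT by (cases t) (simp add: N_def)
  \<comment> \<open>In \<open>hw\<close> the product zxy is 1, so multiplying \<open>t\<close> by z,
    x and y in turn returns to \<open>t\<close>; the two cases already settled thus give the
    third.\<close>
  have N_z: "N (t \<otimes>\<^bsub>hw\<^esub> (1, 0, 1)) = N t \<otimes>\<^bsub>P\<^esub> z" if t: "t \<in> carrier hw" for t
  proof -
    interpret hw: group hw by (rule group_hw)
    let ?s = "t \<otimes>\<^bsub>hw\<^esub> (1, 0, 1)"
    have s: "?s \<in> carrier hw" using t by (intro hw.m_closed) auto
    have "?s \<otimes>\<^bsub>hw\<^esub> (1, 1, 0) \<otimes>\<^bsub>hw\<^esub> (0, 1, 1) = t"
      using t by (cases t) (simp add: par_odd)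
    then have "N t = N ?s \<otimes>\<^bsub>P\<^esub> x \<otimes>\<^bsub>P\<^esub> y"
      using N_y[of "?s \<otimes>\<^bsub>hw\<^esub> (1, 1, 0)"] N_x[OF s] hw.m_closed[OF s, of "(1, 1, 0)"] by simp
    then have "N t \<otimes>\<^bsub>P\<^esub> z = N ?s \<otimes>\<^bsub>P\<^esub> (x \<otimes>\<^bsub>P\<^esub> y \<otimes>\<^bsub>P\<^esub> z)" using carN car by (simp add: P.m_assoc)
    then show ?thesis using r3 carN by simp
  qed
  have "P \<cong> hw"
    unfolding P_def
  proof (rule group.presented_group_iso[OF group_hw, where h = hw_gen and N = N])
    show "hw_gen g \<in> carrier hw" for g by (cases g) (simp_all add: hw_gen_def)
    show "word_eval hw hw_gen l = word_eval hw hw_gen r" if "(l, r) \<in> R" for l r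
      using that by (auto simp: R_def word_inv_def hw_gen_def par_odd)
    show "carrier hw \<subseteq> J" if J: "subgroup J hw" "range hw_gen \<subseteq> J" for J
    proof -
      have "hw_gen g \<in> J" for g using J(2) by blast
      from this[of GenX] this[of GenY] show ?thesis
        using hw_generated[OF J(1)] by (auto simp: hw_gen_def)
    qed
    show "N \<one>\<^bsub>hw\<^esub> = \<one>\<^bsub>presented_group R\<^esub>"
      using carX by (simp add: N_def T_def P_def[symmetric])
    show "N t \<in> carrier (presented_group R)" for t
      using carN by (simp add: P_def)
    show "N (t \<otimes>\<^bsub>hw\<^esub> hw_gen g) = N t \<otimes>\<^bsub>presented_group R\<^esub> pres_class R [(g, True)]"
      if "t \<in> carrier hw" for t g
      using N_x[OF that] N_y[OF that] N_z[OF that]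
      by (cases g) (simp_all add: hw_gen_def xyz c_def P_def)
  qed
  then show ?thesis by (simp add: pi1_G6_def R_def P_def)
qed

section \<open>Subgroups of the Hantzsche--Wendt group\<close>

definition lattice_emb :: "int \<times> int \<times> int \<Rightarrow> int \<times> int \<times> int" where
  "lattice_emb = (\<lambda>(i, j, k). (2 * i, 2 * j, 2 * k))"

text \<open>The generator of the factor Z goes to the screw motion \<open>(1, 1, 0)\<close> along
  the first axis, whose \<open>k\<close>-th power is \<open>(k, acc True k, 0)\<close>;
  \<open>i\<close> and \<open>j\<close> give the translations across that axis.\<close>

definition axis_emb :: "int \<times> int \<times> int \<Rightarrow> int \<times> int \<times> int" where
  "axis_emb = (\<lambda>(i, j, k). (k, 2 * i + acc True k, 2 * j))"

text \<open>The multiplication of \<open>hw\<close> is invariant under cyclic shifts of the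
  coordinates, so that one axis can stand for all three.\<close>

definition rot :: "int \<times> int \<times> int \<Rightarrow> int \<times> int \<times> int" where
  "rot = (\<lambda>(a, b, c). (c, a, b))"

lemma emb_simps [simp]:
  "lattice_emb (i, j, k) = (2 * i, 2 * j, 2 * k)"
  "axis_emb (i, j, k) = (k, 2 * i + acc True k, 2 * j)"
  "rot (a, b, c) = (c, a, b)"
  by (simp_all add: lattice_emb_def axis_emb_def rot_def)

lemma even_acc [simp]: "even (acc True k) \<longleftrightarrow> even k"
  by (simp add: acc_def)

lemma par_acc [simp]: "par (acc True k) = par k"
  by (simp add: twist_def)

lemma hom_lattice_emb: "lattice_emb \<in> hom (semi False) hw"
  by (auto simp: hom_def)

lemma hom_axis_emb: "axis_emb \<in> hom (semi True) hw"
  by (auto simp: hom_def acc_add algebra_simps)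

lemma hom_rot: "rot \<in> hom hw hw"
  by (auto simp: hom_def)

lemma inj_emb: "inj lattice_emb" "inj axis_emb" "inj rot"
  by (auto simp: inj_def)

text \<open>\<open>Lat\<close> consists of the translations, \<open>Axis m\<close> of the elements whose linear part fixes the \<open>m\<close>-th
  coordinate axis pointwise (\<open>m = 0, 1, 2\<close>).\<close>

definition Lat :: "(int \<times> int \<times> int) set" where
  "Lat = {(a, b, c). even a \<and> even b \<and> even c}"

definition Axis :: "nat \<Rightarrow> (int \<times> int \<times> int) set" where
  "Axis m = {(a, b, c). even (a + b + c) \<and> even (if m = 0 then c else if m = 1 then a else b)}"

definition axis_emb_rot :: "nat \<Rightarrow> int \<times> int \<times> int \<Rightarrow> int \<times> int \<times> int" where
  "axis_emb_rot m = (rot ^^ m) \<circ> axis_emb"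

lemma lt3_cases: assumes "m < (3::nat)" obtains "m = 0" | "m = 1" | "m = 2"
  using assms by linarith

lemma hom_axis_emb_rot: "axis_emb_rot m \<in> hom (semi True) hw"
proof (induction m)
  case 0
  then show ?case using hom_axis_emb by (simp add: axis_emb_rot_def)
next
  case (Suc m)
  have "rot \<circ> axis_emb_rot m \<in> hom (semi True) hw" using Group.hom_compose[OF Suc hom_rot] .
  moreover have "axis_emb_rot (Suc m) = rot \<circ> axis_emb_rot m" by (simp add: axis_emb_rot_def fun_eq_iff)
  ultimately show ?case by metis
qed

lemma inj_axis_emb_rot: "inj (axis_emb_rot m)"
  unfolding axis_emb_rot_def by (intro inj_compose inj_fn inj_emb)

lemma range_lattice_emb: "range lattice_emb = Lat"
  by (auto simp: Lat_def image_iff elim!: evenE)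

lemma range_axis_emb: "range axis_emb = Axis 0"
proof
  show "range axis_emb \<subseteq> Axis 0" by (auto simp: Axis_def)
  show "Axis 0 \<subseteq> range axis_emb"
  proof
    fix t assume t: "t \<in> Axis 0"
    obtain a b c where abc: "t = (a, b, c)" by (cases t)
    have "even (b - acc True a)" "even c" using t by (auto simp: abc Axis_def)
    then obtain i j where "b - acc True a = 2 * i" "c = 2 * j" by (metis evenE)
    then have "t = axis_emb (i, j, a)" by (simp add: abc algebra_simps)
    then show "t \<in> range axis_emb" by blast
  qed
qed

lemma range_axis_emb_rot:
  assumes "m < 3"
  shows "range (axis_emb_rot m) = Axis m"
proof -
  have 1: "rot ` Axis 0 = Axis 1"
    by (force simp: Axis_def image_iff)
  have 2: "rot ` Axis 1 = Axis 2"
    by (force simp: Axis_def image_iff)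
  have *: "range (axis_emb_rot m) = (rot ^^ m) ` Axis 0"
    unfolding axis_emb_rot_def range_axis_emb[symmetric] by (simp only: image_comp)
  from assms show ?thesis
    unfolding * by (cases rule: lt3_cases)
      (use 1 2 in \<open>simp_all add: numeral_2_eq_2 image_image[of rot rot, symmetric]\<close>)
qed

lemma subgroup_Lat: "subgroup Lat hw"
  using group_hom.img_is_subgroup[of "semi False" hw lattice_emb] hom_lattice_emb group_semi group_hw
  by (simp add: range_lattice_emb group_hom_def group_hom_axioms_def)

lemma subgroup_Axis: "m < 3 \<Longrightarrow> subgroup (Axis m) hw"
  using group_hom.img_is_subgroup[of "semi True" hw "axis_emb_rot m"] hom_axis_emb_rot group_semi group_hw
  by (simp add: range_axis_emb_rot group_hom_def group_hom_axioms_def)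

lemma transversal_Lat:
  assumes g: "g \<in> carrier hw"
  shows "\<exists>!t. t \<in> {(0, 0, 0), (1, 1, 0), (0, 1, 1), (1, 0, 1)} \<and> g \<in> Lat #>\<^bsub>hw\<^esub> t"
proof -
  obtain a b c where abc: "g = (a, b, c)" by (cases g)
  have mem: "g \<in> Lat #>\<^bsub>hw\<^esub> (a', b', c') \<longleftrightarrow>
      even (a - a') \<and> even (b - b') \<and> even (c - c')" if "even (a' + b' + c')" for a' b' c'
    using subgroup.rcos_module[OF subgroup_Lat group_hw _ g, of "(a', b', c')"] that
    by (simp add: abc Lat_def)
  have *: "g \<in> Lat #>\<^bsub>hw\<^esub> (0, 0, 0) \<longleftrightarrow> even a \<and> even b \<and> even c"
    "g \<in> Lat #>\<^bsub>hw\<^esub> (1, 1, 0) \<longleftrightarrow> odd a \<and> odd b \<and> even c"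
    "g \<in> Lat #>\<^bsub>hw\<^esub> (0, 1, 1) \<longleftrightarrow> even a \<and> odd b \<and> odd c"
    "g \<in> Lat #>\<^bsub>hw\<^esub> (1, 0, 1) \<longleftrightarrow> odd a \<and> even b \<and> odd c"
    by (simp_all add: mem)
  have "even (a + b + c)" using g by (simp add: abc)
  then show ?thesis
    by (cases "even a"; cases "even b") (auto simp: *)
qed

text \<open>For \<open>m < 3\<close>, a representative of the nontrivial coset of
  \<open>Axis m\<close>, which has index two.\<close>

definition off_axis :: "nat \<Rightarrow> int \<times> int \<times> int" where
  "off_axis m = (if m = 0 then (0, 1, 1) else if m = 1 then (1, 0, 1) else (1, 1, 0))"

lemma transversal_Axis:
  assumes g: "g \<in> carrier hw" and m: "m < 3"
  shows "\<exists>!t. t \<in> {(0, 0, 0), off_axis m} \<and> g \<in> Axis m #>\<^bsub>hw\<^esub> t"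
proof -
  obtain a b c where abc: "g = (a, b, c)" by (cases g)
  have ev: "even (a + b + c)" using g by (simp add: abc)
  have mem: "g \<in> Axis m #>\<^bsub>hw\<^esub> (a', b', c') \<longleftrightarrow>
      even (if m = 0 then c - c' else if m = 1 then a - a' else b - b')"
    if "even (a' + b' + c')" for a' b' c'
    using subgroup.rcos_module[OF subgroup_Axis[OF m] group_hw _ g, of "(a', b', c')"] that ev
    by (simp add: abc Axis_def split: if_splits) argo+
  define even_on where "even_on = even (if m = 0 then c else if m = 1 then a else b)"
  have "g \<in> Axis m #>\<^bsub>hw\<^esub> (0, 0, 0) \<longleftrightarrow> even_on" by (simp add: mem even_on_def)
  moreover have "g \<in> Axis m #>\<^bsub>hw\<^esub> off_axis m \<longleftrightarrow> \<not> even_on"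
    using m mem[of 0 1 1] mem[of 1 0 1] mem[of 1 1 0]
    by (cases rule: lt3_cases) (simp_all add: even_on_def off_axis_def)
  moreover have "off_axis m \<noteq> (0, 0, 0)" by (simp add: off_axis_def)
  ultimately show ?thesis by (metis insert_iff singletonD)
qed

text \<open>The subgroups inside the range are the images of the subgroups of \<open>semi e\<close>,
  with indices multiplied by \<open>card T\<close>. The rational argument of \<open>omega\<close>
  absorbs the question of divisibility, and the parity of \<open>l\<close> decides the isomorphism
  type.\<close>

lemma subgroups_within_emb:
  assumes \<psi>: "\<psi> \<in> hom (semi e) hw" and inj: "inj \<psi>" and T: "T \<subseteq> carrier hw" "finite T" "T \<noteq> {}"
    and ex1: "\<And>g. g \<in> carrier hw \<Longrightarrow> \<exists>!t. t \<in> T \<and> g \<in> range \<psi> #>\<^bsub>hw\<^esub> t"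
  defines "S \<equiv> \<lambda>n. {\<Delta>. subgroup \<Delta> hw \<and> \<Delta> \<subseteq> range \<psi> \<and> card (rcosets\<^bsub>hw\<^esub> \<Delta>) = n}"
  assumes n: "n > 0"
  shows "finite (S n)" and "int (card (S n)) = omega (of_nat n / of_nat (card T))"
    and "\<Delta> \<in> S n \<Longrightarrow> \<exists>a b l r u v. \<Delta> = \<psi> ` range (semi_emb e a b l r u v) \<and>
      hw\<lparr>carrier := \<Delta>\<rparr> \<cong> semi (e \<and> odd l)"
proof -
  interpret semi: group "semi e" by (rule group_semi)
  interpret hw: group hw by (rule group_hw)
  interpret \<psi>: group_hom "semi e" hw \<psi> by unfold_locales fact
  define q :: rat where "q = of_nat n / of_nat (card T)"
  have cT: "card T > 0" using T by (simp add: card_gt_0_iff)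
  then have q: "q > 0" using n by (simp add: q_def)
  define S' where "S' = {H. subgroup H (semi e) \<and> of_nat (card (rcosets\<^bsub>semi e\<^esub> H)) = q}"
  have index: "card (rcosets\<^bsub>hw\<^esub> (\<psi> ` H)) = card (rcosets\<^bsub>semi e\<^esub> H) * card T"
    if "subgroup H (semi e)" for H
    by (rule card_rcosets_image[OF group_semi group_hw \<psi> _ that T(1)]) (use inj ex1 in simp_all)
  have index_q: "card (rcosets\<^bsub>hw\<^esub> (\<psi> ` H)) = n \<longleftrightarrow> of_nat (card (rcosets\<^bsub>semi e\<^esub> H)) = q"
    if "subgroup H (semi e)" for H
    unfolding index[OF that] q_def using cT
    by (simp add: eq_divide_eq of_nat_mult[symmetric] del: of_nat_mult)
  have pre: "\<exists>H. H \<in> S' \<and> \<Delta> = \<psi> ` H" if \<Delta>S: "\<Delta> \<in> S n" for \<Delta>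
  proof -
    have \<Delta>: "subgroup \<Delta> hw" "\<Delta> \<subseteq> range \<psi>" "card (rcosets\<^bsub>hw\<^esub> \<Delta>) = n"
      using \<Delta>S by (simp_all add: S_def)
    have H: "subgroup {t \<in> carrier (semi e). \<psi> t \<in> \<Delta>} (semi e)"
      by (rule \<psi>.subgroup_preimage[OF \<Delta>(1)])
    moreover have "\<Delta> = \<psi> ` {t \<in> carrier (semi e). \<psi> t \<in> \<Delta>}" using \<Delta>(2) by auto
    ultimately show ?thesis using \<Delta>(3) index_q[OF H] unfolding S'_def by auto
  qed
  have "bij_betw ((`) \<psi>) S' (S n)"
  proof (rule bij_betw_imageI)
    show "inj_on ((`) \<psi>) S'" using inj by (auto simp: inj_on_def inj_image_eq_iff)
    show "(`) \<psi> ` S' = S n"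
    proof
      show "(`) \<psi> ` S' \<subseteq> S n"
        using index_q \<psi>.subgroup_img_is_subgroup by (auto simp: S'_def S_def)
      show "S n \<subseteq> (`) \<psi> ` S'" using pre by blast
    qed
  qed
  with semi_subgroups_card[OF q, of e] show "finite (S n)"
    and "int (card (S n)) = omega (of_nat n / of_nat (card T))"
    by (auto simp: S'_def[symmetric] q_def[symmetric] bij_betw_finite bij_betw_same_card)
  show "\<exists>a b l r u v. \<Delta> = \<psi> ` range (semi_emb e a b l r u v) \<and>
      hw\<lparr>carrier := \<Delta>\<rparr> \<cong> semi (e \<and> odd l)" if \<Delta>S: "\<Delta> \<in> S n"
  proof -
    obtain H where H: "H \<in> S'" and \<Delta>: "\<Delta> = \<psi> ` H" using pre[OF \<Delta>S] by blast
    have sH: "subgroup H (semi e)" and cH: "of_nat (card (rcosets\<^bsub>semi e\<^esub> H)) = q"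
      using H by (auto simp: S'_def)
    have "finite (rcosets\<^bsub>semi e\<^esub> H)" using cH q card.infinite by fastforce
    then obtain a b l r u v where pos: "a > 0" "b > 0" "l > 0"
      and HE: "H = range (semi_emb e a b l r u v)"
      by (rule semi_finite_index_subgroup[OF sH])
    have "semi e\<lparr>carrier := H\<rparr> \<cong> semi (e \<and> odd l)"
      using semi.image_iso[OF group_semi semi_emb_hom[of e a b l r u v]] semi_emb_inj[OF pos]
      by (simp add: HE)
    moreover have "semi e\<lparr>carrier := H\<rparr> \<cong> hw\<lparr>carrier := \<Delta>\<rparr>"
      unfolding \<Delta> by (rule \<psi>.restrict_iso) (use inj sH in simp_all)
    moreover have "group (semi e\<lparr>carrier := H\<rparr>)" by (rule subgroup.subgroup_is_group[OF sH group_semi])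
    ultimately have "hw\<lparr>carrier := \<Delta>\<rparr> \<cong> semi (e \<and> odd l)"
      using group.iso_sym iso_trans by blast
    then show ?thesis using \<Delta> HE by blast
  qed
qed

definition Lat_subgroups :: "nat \<Rightarrow> (int \<times> int \<times> int) set set" where
  "Lat_subgroups n = {\<Delta>. subgroup \<Delta> hw \<and> \<Delta> \<subseteq> Lat \<and> card (rcosets\<^bsub>hw\<^esub> \<Delta>) = n}"

definition Axis_subgroups :: "nat \<Rightarrow> nat \<Rightarrow> (int \<times> int \<times> int) set set" where
  "Axis_subgroups m n = {\<Delta>. subgroup \<Delta> hw \<and> \<Delta> \<subseteq> Axis m \<and> card (rcosets\<^bsub>hw\<^esub> \<Delta>) = n}"

lemma Lat_subgroups:
  assumes "n > 0"
  shows "finite (Lat_subgroups n)" and "int (card (Lat_subgroups n)) = omega (of_nat n / 4)"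
    and "\<Delta> \<in> Lat_subgroups n \<Longrightarrow> hw\<lparr>carrier := \<Delta>\<rparr> \<cong> semi False"
proof -
  have T: "{(0, 0, 0), (1, 1, 0), (0, 1, 1), (1, 0, 1)} \<subseteq> carrier hw" by auto
  note * = subgroups_within_emb[OF hom_lattice_emb inj_emb(1) T _ _ _ assms,
      unfolded range_lattice_emb Lat_subgroups_def[symmetric], OF _ _ transversal_Lat]
  show "finite (Lat_subgroups n)" "int (card (Lat_subgroups n)) = omega (of_nat n / 4)"
    using *(1,2) by auto
  show "hw\<lparr>carrier := \<Delta>\<rparr> \<cong> semi False" if "\<Delta> \<in> Lat_subgroups n"
    using *(3)[OF _ _ _ that] by auto
qed

lemma Axis_subgroups:
  assumes "n > 0" and m: "m < 3"
  shows "finite (Axis_subgroups m n)" and "int (card (Axis_subgroups m n)) = omega (of_nat n / 2)"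
    and "\<Delta> \<in> Axis_subgroups m n \<Longrightarrow> \<not> \<Delta> \<subseteq> Lat \<Longrightarrow> hw\<lparr>carrier := \<Delta>\<rparr> \<cong> semi True"
proof -
  have T: "{(0, 0, 0), off_axis m} \<subseteq> carrier hw" "card {(0, 0, 0), off_axis m} = 2"
    by (auto simp: off_axis_def)
  note * = subgroups_within_emb[OF hom_axis_emb_rot[of m] inj_axis_emb_rot T(1) _ _ _ assms(1),
      unfolded range_axis_emb_rot[OF m] Axis_subgroups_def[symmetric], OF _ _ transversal_Axis[OF _ m]]
  show "finite (Axis_subgroups m n)" "int (card (Axis_subgroups m n)) = omega (of_nat n / 2)"
    using *(1,2) T(2) by auto
  assume \<Delta>A: "\<Delta> \<in> Axis_subgroups m n"
  obtain a b l r u v where \<Delta>: "\<Delta> = axis_emb_rot m ` range (semi_emb True a b l r u v)"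
      and iso: "hw\<lparr>carrier := \<Delta>\<rparr> \<cong> semi (True \<and> odd l)"
    using *(3)[OF _ _ _ \<Delta>A] by auto
  assume "\<not> \<Delta> \<subseteq> Lat"
  \<comment> \<open>For even \<open>l\<close> all coordinates along the axis are even, so
    \<open>axis_emb\<close> takes values in \<open>Lat\<close>, which the rotation
    preserves.\<close>
  moreover have "\<Delta> \<subseteq> Lat" if "even l"
  proof -
    have rot: "rot ` Lat \<subseteq> Lat" by (auto simp: Lat_def)
    have "(rot ^^ m) ` Lat \<subseteq> Lat"
    proof (induction m)
      case (Suc m)
      have "(rot ^^ Suc m) ` Lat = rot ` (rot ^^ m) ` Lat" by (simp add: image_comp)
      then show ?case using Suc rot by blast
    qed simp
    moreover have "axis_emb ` range (semi_emb True a b l r u v) \<subseteq> Lat"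
      using that by (auto simp: Lat_def)
    ultimately show ?thesis unfolding \<Delta> axis_emb_rot_def image_comp[symmetric] by blast
  qed
  ultimately have "odd l" by blast
  with iso show "hw\<lparr>carrier := \<Delta>\<rparr> \<cong> semi True" by simp
qed

text \<open>Two even coordinates and an even sum make the remaining coordinate even.\<close>

lemma Axis_Int: "m < 3 \<Longrightarrow> m' < 3 \<Longrightarrow> m \<noteq> m' \<Longrightarrow> Axis m \<inter> Axis m' \<subseteq> Lat"
  by (auto simp: Axis_def Lat_def split: if_splits)

lemma Lat_subset_Axis: "Lat \<subseteq> Axis m"
  by (auto simp: Axis_def Lat_def)

text \<open>\<open>Lat\<close> lies in all three axis groups and contains their pairwise
  intersections; once the subgroups of \<open>Lat\<close> are removed, the three families are
  disjoint and equally large.\<close>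

lemma card_Axis_not_Lat:
  assumes n: "n > 0"
  defines "B \<equiv> (\<Union>m<3. Axis_subgroups m n - Lat_subgroups n)"
  shows "finite B" and "int (card B) = 3 * omega (of_nat n / 2) - 3 * omega (of_nat n / 4)"
proof -
  have fin: "finite (Axis_subgroups m n - Lat_subgroups n)" if "m < 3" for m
    using Axis_subgroups(1)[OF n that] by simp
  then show "finite B" unfolding B_def by (intro finite_UN_I finite_lessThan) simp
  have disj: "(Axis_subgroups m n - Lat_subgroups n) \<inter> (Axis_subgroups m' n - Lat_subgroups n) = {}"
    if "m < 3" "m' < 3" "m \<noteq> m'" for m m'
    using Axis_Int[OF that] by (auto simp: Axis_subgroups_def Lat_subgroups_def)
  have "int (card (Axis_subgroups m n - Lat_subgroups n)) = omega (of_nat n / 2) - omega (of_nat n / 4)"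
    if "m < 3" for m
  proof -
    have sub: "Lat_subgroups n \<subseteq> Axis_subgroups m n"
      using Lat_subset_Axis by (auto simp: Axis_subgroups_def Lat_subgroups_def)
    then show ?thesis
      using Axis_subgroups(1,2)[OF n that] Lat_subgroups(1,2)[OF n] card_mono[OF _ sub]
      by (simp add: card_Diff_subset of_nat_diff)
  qed
  moreover have "card B = (\<Sum>m<3. card (Axis_subgroups m n - Lat_subgroups n))"
    unfolding B_def by (rule card_UN_disjoint) (use fin disj in auto)
  ultimately show "int (card B) = 3 * omega (of_nat n / 2) - 3 * omega (of_nat n / 4)"
    by simp
qed

section \<open>The three isomorphism types are distinct\<close>

lemma semi_True_not_iso_False: "\<not> semi True \<cong> semi False"
proof
  assume "semi True \<cong> semi False"
  then have "semi False \<cong> semi True" by (rule group.iso_sym[OF group_semi])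
  moreover have "comm_group (semi False)"
    by (rule group.group_comm_groupI[OF group_semi]) auto
  ultimately have "comm_group (semi True)"
    using comm_group.iso_imp_comm_group group.is_monoid[OF group_semi] by blast
  then show False
    using comm_groupE(4)[of "semi True" "(0, 0, 1)" "(1, 0, 0)"] by (simp add: par_odd)
qed

lemma hw_not_iso_False: "\<not> hw \<cong> semi False"
proof
  assume "hw \<cong> semi False"
  then have "semi False \<cong> hw" by (rule group.iso_sym[OF group_hw])
  moreover have "comm_group (semi False)"
    by (rule group.group_comm_groupI[OF group_semi]) auto
  ultimately have "comm_group hw"
    using comm_group.iso_imp_comm_group group.is_monoid[OF group_hw] by blast
  then show False
    using comm_groupE(4)[of hw "(1, 1, 0)" "(0, 1, 1)"] by (simp add: par_odd)
qed

text \<open>Every homomorphism from \<open>hw\<close> to the integers vanishes on the generators by the first two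
  relations, whereas \<open>semi True\<close> maps onto the integers.\<close>

lemma hw_not_iso_True: "\<not> hw \<cong> semi True"
proof
  assume "hw \<cong> semi True"
  then obtain \<phi> where \<phi>: "\<phi> \<in> hom hw (semi True)" and bij: "bij_betw \<phi> (carrier hw) UNIV"
    by (auto simp: is_iso_def iso_def)
  define f where "f t = snd (snd (\<phi> t))" for t
  have f: "f (s \<otimes>\<^bsub>hw\<^esub> t) = f s + f t" if "s \<in> carrier hw" "t \<in> carrier hw" for s t
  proof -
    have "\<phi> (s \<otimes>\<^bsub>hw\<^esub> t) = \<phi> s \<otimes>\<^bsub>semi True\<^esub> \<phi> t" using \<phi> that by (simp add: hom_def)
    then show ?thesis by (cases "\<phi> s"; cases "\<phi> t") (simp add: f_def)
  qed
  have f0: "f (0, 0, 0) = 0" using f[of "(0, 0, 0)" "(0, 0, 0)"] by simp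
  \<comment> \<open>In \<open>hw\<close> the product of \<open>(0, 1, 1)\<close> and
    \<open>(2, 0, 0)\<close> equals that of \<open>(- 2, 0, 0)\<close> and \<open>(0, 1, 1)\<close>.
    So \<open>f\<close> takes opposite values that are equal at \<open>(2, 0, 0)\<close>, the square
    of \<open>(1, 1, 0)\<close>.\<close>
  have x: "f (1, 1, 0) = 0"
    using f[of "(1, 1, 0)" "(1, 1, 0)"] f[of "(0, 1, 1)" "(2, 0, 0)"] f[of "(- 2, 1, 1)" "(2, 0, 0)"]
      f[of "(2, 0, 0)" "(0, 1, 1)"] f[of "(- 2, 0, 0)" "(2, 0, 0)"] f[of "(- 2, 0, 0)" "(0, 1, 1)"]
    by (simp add: par_odd f0)
  have y: "f (0, 1, 1) = 0"
    using f[of "(0, 1, 1)" "(0, 1, 1)"] f[of "(1, 1, 0)" "(0, 2, 0)"]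
      f[of "(0, - 2, 0)" "(0, 2, 0)"] f[of "(0, - 2, 0)" "(1, 1, 0)"]
    by (simp add: par_odd f0)
  interpret hw: group hw by (rule group_hw)
  have "f (inv\<^bsub>hw\<^esub> t) = - f t" if "t \<in> carrier hw" for t
    using f[of "inv\<^bsub>hw\<^esub> t" t] that f0 by simp
  then have "subgroup {t \<in> carrier hw. f t = 0} hw" (is "subgroup ?J hw")
    using f f0 by (intro hw.subgroupI) auto
  moreover have "(1, 1, 0) \<in> ?J" "(0, 1, 1) \<in> ?J" using x y by simp_all
  ultimately have ker: "t \<in> ?J" if "t \<in> carrier hw" for t using that by (rule hw_generated)
  have "(0, 0, 1) \<in> \<phi> ` carrier hw" using bij by (simp add: bij_betw_def)
  then obtain t where "(0, 0, 1) = \<phi> t" "t \<in> carrier hw" by (rule imageE)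
  then show False using ker[of t] by (simp add: f_def) (metis snd_conv zero_neq_one)
qed

section \<open>Subgroups with full image in the Klein four-group\<close>

lemma par_odd_mult [simp]: "odd p \<Longrightarrow> par (p * a) = par a"
  by (simp add: twist_def)

lemma acc_par_mult [simp]: "acc True (par b * c) = acc True c"
  by (auto simp: acc_def twist_def) presburger

lemma acc_even_odd: "even a \<Longrightarrow> acc True a = 0" "odd a \<Longrightarrow> acc True a = 1"
  by (simp_all add: acc_def odd_iff_mod_2_eq_one)

text \<open>Conjugation of the group by the affine map \<open>(x, y, z) \<mapsto> (p x + u, q y + v, r z + w)\<close>.\<close>

definition hw_emb :: "int \<Rightarrow> int \<Rightarrow> int \<Rightarrow> int \<Rightarrow> int \<Rightarrow> int \<Rightarrow> int \<times> int \<times> int \<Rightarrow> int \<times> int \<times> int" where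
  "hw_emb p q r u v w = (\<lambda>(a, b, c).
    (p * a + 2 * u * acc True c, q * b + 2 * v * acc True a, r * c + 2 * w * acc True b))"

lemma hw_emb_apply [simp]: "hw_emb p q r u v w (a, b, c) =
    (p * a + 2 * u * acc True c, q * b + 2 * v * acc True a, r * c + 2 * w * acc True b)"
  by (simp add: hw_emb_def)

text \<open>Odd factors and even shifts preserve the parities and with them every sign in the
  multiplication; the rest is the cocycle identity \<open>acc_add\<close>.\<close>

lemma hw_emb_hom:
  assumes "odd p" "odd q" "odd r"
  shows "hw_emb p q r u v w \<in> hom hw hw"
  using assms by (auto simp: hom_def acc_add distrib_left)

lemma hw_emb_inj:
  assumes odd: "odd p" "odd q" "odd r"
  shows "inj (hw_emb p q r u v w)"
proof (rule injI)
  fix s t :: "int \<times> int \<times> int" assume eq: "hw_emb p q r u v w s = hw_emb p q r u v w t"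
  obtain a b c a' b' c' where st: "s = (a, b, c)" "t = (a', b', c')" by (cases s; cases t)
  have e: "p * a + 2 * u * acc True c = p * a' + 2 * u * acc True c'"
    "q * b + 2 * v * acc True a = q * b' + 2 * v * acc True a'"
    "r * c + 2 * w * acc True b = r * c' + 2 * w * acc True b'"
    using eq by (simp_all add: st)
  have "even a \<longleftrightarrow> even a'" "even b \<longleftrightarrow> even b'" "even c \<longleftrightarrow> even c'"
    using arg_cong[OF e(1), of even] arg_cong[OF e(2), of even] arg_cong[OF e(3), of even] odd
    by simp_all
  then have "acc True a = acc True a'" "acc True b = acc True b'" "acc True c = acc True c'"
    using acc_even_odd by metis+
  then have "p * a = p * a'" "q * b = q * b'" "r * c = r * c'" using e by simp_all
  moreover have "p \<noteq> 0" "q \<noteq> 0" "r \<noteq> 0" using odd by auto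
  ultimately show "s = t" by (simp add: st)
qed

lemma subgroup_hw_emb:
  assumes "odd p" "odd q" "odd r"
  shows "subgroup (hw_emb p q r u v w ` carrier hw) hw"
  using group_hom.img_is_subgroup[of hw hw "hw_emb p q r u v w"] group_hw hw_emb_hom[OF assms]
  by (simp add: group_hom_def group_hom_axioms_def)

text \<open>Image and preimage have the same parities, so the shifts can be expressed through
  \<open>x\<close>, \<open>y\<close>, \<open>z\<close> themselves.\<close>

lemma hw_emb_mem:
  assumes "odd p" "odd q" "odd r"
  shows "(x, y, z) \<in> hw_emb p q r u v w ` carrier hw \<longleftrightarrow> even (x + y + z) \<and>
    p dvd x - 2 * u * acc True z \<and> q dvd y - 2 * v * acc True x \<and> r dvd z - 2 * w * acc True y"
proof
  assume "(x, y, z) \<in> hw_emb p q r u v w ` carrier hw"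
  then obtain a b c where abc: "even (a + b + c)" "x = p * a + 2 * u * acc True c"
    "y = q * b + 2 * v * acc True a" "z = r * c + 2 * w * acc True b" by (auto simp: image_iff)
  have "even x \<longleftrightarrow> even a" "even y \<longleftrightarrow> even b" "even z \<longleftrightarrow> even c" using abc assms by simp_all
  then have "acc True x = acc True a" "acc True y = acc True b" "acc True z = acc True c"
    using acc_even_odd by metis+
  then show "even (x + y + z) \<and>
    p dvd x - 2 * u * acc True z \<and> q dvd y - 2 * v * acc True x \<and> r dvd z - 2 * w * acc True y"
    using abc assms by simp
next
  assume *: "even (x + y + z) \<and>
    p dvd x - 2 * u * acc True z \<and> q dvd y - 2 * v * acc True x \<and> r dvd z - 2 * w * acc True y"
  then obtain a b c where "x - 2 * u * acc True z = p * a" "y - 2 * v * acc True x = q * b"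
    "z - 2 * w * acc True y = r * c" by (auto simp: dvd_def)
  then have abc: "x = p * a + 2 * u * acc True z" "y = q * b + 2 * v * acc True x"
    "z = r * c + 2 * w * acc True y" by simp_all
  have "even x \<longleftrightarrow> even a" "even y \<longleftrightarrow> even b" "even z \<longleftrightarrow> even c"
    using arg_cong[OF abc(1), of even] arg_cong[OF abc(2), of even] arg_cong[OF abc(3), of even]
      assms by simp_all
  then have e: "acc True x = acc True a" "acc True y = acc True b" "acc True z = acc True c"
    and "even (a + b + c)"
    using acc_even_odd * by (metis, metis, metis, simp)
  then have "(x, y, z) = hw_emb p q r u v w (a, b, c)" using abc unfolding e by simp
  then show "(x, y, z) \<in> hw_emb p q r u v w ` carrier hw"
    using \<open>even (a + b + c)\<close> by (simp only: imageI hw_simps)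
qed

lemma odd_dvd_double: "odd (d :: int) \<Longrightarrow> d dvd 2 * m \<longleftrightarrow> d dvd m"
  by (simp add: coprime_dvd_mult_right_iff coprime_commute)

text \<open>2 is invertible modulo an odd \<open>d\<close>; hence translations by even amounts run
  through all residues.\<close>

lemma ex1_half_residue:
  fixes d m :: int
  assumes d: "odd d" "d > 0"
  shows "\<exists>!i. i \<in> {0..<d} \<and> d dvd m - 2 * i"
proof -
  obtain h where h: "d = 2 * h + 1" using d by (auto elim: oddE)
  \<comment> \<open>\<open>h + 1\<close> is the inverse of 2 modulo
    \<open>d = 2 * h + 1\<close>.\<close>
  define i where "i = (m * (h + 1)) mod d"
  have "m * (h + 1) - i = (m * (h + 1)) div d * d" by (simp add: i_def minus_mod_eq_div_mult)
  then have "m - 2 * i = d * (2 * (m * (h + 1) div d) - m)" by (simp add: h algebra_simps)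
  then have "d dvd m - 2 * i" by simp
  moreover have "i \<in> {0..<d}" using d by (simp add: i_def)
  moreover have "j = i" if "j \<in> {0..<d}" "d dvd m - 2 * j" for j
  proof -
    have "d dvd (m - 2 * i) - (m - 2 * j)" using that(2) \<open>d dvd m - 2 * i\<close> by (rule dvd_diff[rotated])
    then have "d dvd 2 * (j - i)" by (simp add: algebra_simps)
    then have "d dvd j - i" using d odd_dvd_double by blast
    then show ?thesis using that \<open>i \<in> {0..<d}\<close> by (intro int_eq_if_dvd_diff) auto
  qed
  ultimately show ?thesis by blast
qed

text \<open>The image contains elements of all four parity classes, so translations already
  represent all cosets and only the index of the box in the lattice counts.\<close>

lemma card_rcosets_hw_emb:
  assumes odd: "odd p" "odd q" "odd r" and pos: "p > 0" "q > 0" "r > 0"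
  shows "card (rcosets\<^bsub>hw\<^esub> (hw_emb p q r u v w ` carrier hw)) = nat p * nat q * nat r"
proof -
  interpret group hw by (rule group_hw)
  let ?H = "hw_emb p q r u v w ` carrier hw"
  let ?I = "{0..<p} \<times> {0..<q} \<times> {0..<r}"
  have "bij_betw (\<lambda>t. ?H #>\<^bsub>hw\<^esub> lattice_emb t) ?I (rcosets\<^bsub>hw\<^esub> ?H)"
  proof (rule bij_betw_transversal[OF subgroup_hw_emb[OF odd]])
    show "lattice_emb t \<in> carrier hw" for t by (cases t) simp
    fix g assume g: "g \<in> carrier hw"
    obtain x y z where xyz: "g = (x, y, z)" by (cases g)
    \<comment> \<open>Dividing by the translation puts a sign on \<open>2 * i\<close>; transferring
      it to the known part, as in \<open>m1\<close>, leaves a plain congruence for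
      \<open>2 * i\<close>.\<close>
    define m1 where "m1 = par z * (x - 2 * u * acc True z)"
    define m2 where "m2 = par x * (y - 2 * v * acc True x)"
    define m3 where "m3 = par y * (z - 2 * w * acc True y)"
    have dvd_par: "d dvd a - par k * b - c \<longleftrightarrow> d dvd par k * (a - c) - b" for d a b c k :: int
    proof -
      have "par k * (a - c) - b = par k * (a - par k * b - c)" by (simp add: right_diff_distrib)
      moreover have "d dvd par k * n \<longleftrightarrow> d dvd n" for n by (simp add: twist_def)
      ultimately show ?thesis by metis
    qed
    have mem: "g \<in> ?H #>\<^bsub>hw\<^esub> lattice_emb (i, j, k) \<longleftrightarrow>
        p dvd m1 - 2 * i \<and> q dvd m2 - 2 * j \<and> r dvd m3 - 2 * k" for i j k
    proof -
      have acc: "acc True (l - par l' * (2 * n)) = acc True l" for l l' n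
        by (cases "even l") (simp_all add: acc_even_odd)
      have "g \<in> ?H #>\<^bsub>hw\<^esub> lattice_emb (i, j, k) \<longleftrightarrow> g \<otimes>\<^bsub>hw\<^esub> inv\<^bsub>hw\<^esub> lattice_emb (i, j, k) \<in> ?H"
        by (rule subgroup.rcos_module[OF subgroup_hw_emb[OF odd] group_hw _ g]) simp
      also have "g \<otimes>\<^bsub>hw\<^esub> inv\<^bsub>hw\<^esub> lattice_emb (i, j, k) =
          (x - par z * (2 * i), y - par x * (2 * j), z - par y * (2 * k))"
        by (simp add: xyz)
      also have "\<dots> \<in> ?H \<longleftrightarrow> p dvd m1 - 2 * i \<and> q dvd m2 - 2 * j \<and> r dvd m3 - 2 * k"
        using g unfolding hw_emb_mem[OF odd] acc dvd_par m1_def[symmetric] m2_def[symmetric] m3_def[symmetric]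
        by (simp add: xyz)
      finally show ?thesis .
    qed
    obtain i where i: "i \<in> {0..<p}" "p dvd m1 - 2 * i" and i1: "\<And>i'. i' \<in> {0..<p} \<Longrightarrow> p dvd m1 - 2 * i' \<Longrightarrow> i' = i"
      using ex1_half_residue[OF odd(1) pos(1), of m1] by metis
    obtain j where j: "j \<in> {0..<q}" "q dvd m2 - 2 * j" and j1: "\<And>j'. j' \<in> {0..<q} \<Longrightarrow> q dvd m2 - 2 * j' \<Longrightarrow> j' = j"
      using ex1_half_residue[OF odd(2) pos(2), of m2] by metis
    obtain k where k: "k \<in> {0..<r}" "r dvd m3 - 2 * k" and k1: "\<And>k'. k' \<in> {0..<r} \<Longrightarrow> r dvd m3 - 2 * k' \<Longrightarrow> k' = k"
      using ex1_half_residue[OF odd(3) pos(3), of m3] by metis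
    show "\<exists>!t. t \<in> ?I \<and> g \<in> ?H #>\<^bsub>hw\<^esub> lattice_emb t"
    proof (rule ex1I[of _ "(i, j, k)"])
      show "(i, j, k) \<in> ?I \<and> g \<in> ?H #>\<^bsub>hw\<^esub> lattice_emb (i, j, k)" unfolding mem using i j k by simp
      fix t assume t: "t \<in> ?I \<and> g \<in> ?H #>\<^bsub>hw\<^esub> lattice_emb t"
      obtain i' j' k' where t': "t = (i', j', k')" by (cases t)
      show "t = (i, j, k)" using t i1 j1 k1 unfolding t' mem by simp
    qed
  qed
  then have "card (rcosets\<^bsub>hw\<^esub> ?H) = card ?I" by (simp add: bij_betw_same_card)
  then show ?thesis by (simp add: mult.assoc)
qed

text \<open>The even points on the coordinate axes determine the sides. The images of the two
  generators determine twice the offsets modulo the sides, and the factor 2 cancels because the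
  sides are odd.\<close>

lemma hw_emb_image_inj:
  assumes eq: "hw_emb p q r u v w ` carrier hw = hw_emb p' q' r' u' v' w' ` carrier hw"
    and odd: "odd p" "odd q" "odd r" "odd p'" "odd q'" "odd r'"
    and bounds: "0 \<le> u" "u < p" "0 \<le> v" "v < q" "0 \<le> w" "w < r"
      "0 \<le> u'" "u' < p'" "0 \<le> v'" "v' < q'" "0 \<le> w'" "w' < r'"
  shows "p = p' \<and> q = q' \<and> r = r' \<and> u = u' \<and> v = v' \<and> w = w'"
proof -
  note m = hw_emb_mem[OF odd(1-3), where u = u and v = v and w = w]
  note m' = hw_emb_mem[OF odd(4-6), where u = u' and v = v' and w = w', folded eq]
  have acc: "acc True (2 * i) = 0" "acc True 0 = 0" "acc True 1 = 1" for i by (simp_all add: acc_def)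
  have p: "p = p'"
    using m[of "2 * i" 0 0 for i] m'[of "2 * i" 0 0 for i] odd bounds
    by (intro int_eq_if_dvd_iff) (simp_all add: acc odd_dvd_double)
  have q: "q = q'"
    using m[of 0 "2 * i" 0 for i] m'[of 0 "2 * i" 0 for i] odd bounds
    by (intro int_eq_if_dvd_iff) (simp_all add: acc odd_dvd_double)
  have r: "r = r'"
    using m[of 0 0 "2 * i" for i] m'[of 0 0 "2 * i" for i] odd bounds
    by (intro int_eq_if_dvd_iff) (simp_all add: acc odd_dvd_double)
  have "hw_emb p q r u v w (1, 1, 0) \<in> hw_emb p q r u v w ` carrier hw"
    "hw_emb p q r u v w (0, 1, 1) \<in> hw_emb p q r u v w ` carrier hw"
    by (rule imageI, simp)+
  then have 1: "(p, q + 2 * v, 2 * w) \<in> hw_emb p q r u v w ` carrier hw"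
    and 2: "(2 * u, q, r + 2 * w) \<in> hw_emb p q r u v w ` carrier hw" by (simp_all add: acc)
  have "q dvd q + 2 * v - 2 * v'" "r dvd 2 * w - 2 * w'" "p dvd 2 * u - 2 * u'"
    using 1[unfolded m'] 2[unfolded m'] odd by (simp_all add: acc_even_odd p q r)
  then have "q dvd 2 * (v - v')" "r dvd 2 * (w - w')" "p dvd 2 * (u - u')"
    by (simp_all add: right_diff_distrib add_diff_eq[symmetric] del: diff_add_eq)
  then have "q dvd v - v'" "r dvd w - w'" "p dvd u - u'" using odd odd_dvd_double by blast+
  then have "v = v'" "w = w'" "u = u'" using bounds p q r by (auto intro: int_eq_if_dvd_diff)
  then show ?thesis using p q r by simp
qed

text \<open>\<open>\<phi>\<close> is built so that its values at the two generators agree with the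
  given elements modulo the box of translations in \<open>D\<close>, which puts its image inside
  \<open>D\<close>. Conversely, an element of \<open>D\<close> has the same parities as its own
  image under \<open>\<phi>\<close>, so the two differ by a translation in the box.\<close>

lemma hw_full_subgroup:
  assumes D: "subgroup D hw" and fin: "finite (rcosets\<^bsub>hw\<^esub> D)"
    and x: "(k, \<alpha>, \<beta>) \<in> D" "odd k" "odd \<alpha>" "even \<beta>"
    and y: "(\<gamma>, m, \<delta>) \<in> D" "even \<gamma>" "odd m" "odd \<delta>"
  obtains p q r u v w where "odd p" "odd q" "odd r" "p > 0" "q > 0" "r > 0"
    "0 \<le> u" "u < p" "0 \<le> v" "v < q" "0 \<le> w" "w < r" "D = hw_emb p q r u v w ` carrier hw"
proof -
  interpret hw: group hw by (rule group_hw)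
  note mult = subgroup.m_closed[OF D]
  note diff = subgroup.m_closed[OF D _ subgroup.m_inv_closed[OF D]]
  obtain i1 i1' :: int where i1: "i1 \<noteq> i1'" "(2 * i1, 0, 0) \<otimes>\<^bsub>hw\<^esub> inv\<^bsub>hw\<^esub> (2 * i1', 0, 0) \<in> D"
    by (rule hw.ex_diff_mem_finite_index[OF D fin, of "\<lambda>i. (2 * i, 0, 0)"]) auto
  obtain i2 i2' :: int where i2: "i2 \<noteq> i2'" "(0, 2 * i2, 0) \<otimes>\<^bsub>hw\<^esub> inv\<^bsub>hw\<^esub> (0, 2 * i2', 0) \<in> D"
    by (rule hw.ex_diff_mem_finite_index[OF D fin, of "\<lambda>i. (0, 2 * i, 0)"]) auto
  obtain i3 i3' :: int where i3: "i3 \<noteq> i3'" "(0, 0, 2 * i3) \<otimes>\<^bsub>hw\<^esub> inv\<^bsub>hw\<^esub> (0, 0, 2 * i3') \<in> D"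
    by (rule hw.ex_diff_mem_finite_index[OF D fin, of "\<lambda>i. (0, 0, 2 * i)"]) auto
  obtain p where p: "p > 0" "\<And>i. (2 * i, 0, 0) \<in> D \<longleftrightarrow> p dvd i"
  proof (rule int_diff_closed_eq_multiples[of "{i. (2 * i, 0, 0) \<in> D}" "i1 - i1'"])
    show "a - b \<in> {i. (2 * i, 0, 0) \<in> D}" if "a \<in> {i. (2 * i, 0, 0) \<in> D}" "b \<in> {i. (2 * i, 0, 0) \<in> D}" for a b
      using that diff[of "(2 * a, 0, 0)" "(2 * b, 0, 0)"] by (simp add: right_diff_distrib)
    show "i1 - i1' \<in> {i. (2 * i, 0, 0) \<in> D}" "i1 - i1' \<noteq> 0" using i1 by (auto simp: right_diff_distrib)
  qed auto
  obtain q where q: "q > 0" "\<And>i. (0, 2 * i, 0) \<in> D \<longleftrightarrow> q dvd i"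
  proof (rule int_diff_closed_eq_multiples[of "{i. (0, 2 * i, 0) \<in> D}" "i2 - i2'"])
    show "a - b \<in> {i. (0, 2 * i, 0) \<in> D}" if "a \<in> {i. (0, 2 * i, 0) \<in> D}" "b \<in> {i. (0, 2 * i, 0) \<in> D}" for a b
      using that diff[of "(0, 2 * a, 0)" "(0, 2 * b, 0)"] by (simp add: right_diff_distrib)
    show "i2 - i2' \<in> {i. (0, 2 * i, 0) \<in> D}" "i2 - i2' \<noteq> 0" using i2 by (auto simp: right_diff_distrib)
  qed auto
  obtain r where r: "r > 0" "\<And>i. (0, 0, 2 * i) \<in> D \<longleftrightarrow> r dvd i"
  proof (rule int_diff_closed_eq_multiples[of "{i. (0, 0, 2 * i) \<in> D}" "i3 - i3'"])
    show "a - b \<in> {i. (0, 0, 2 * i) \<in> D}" if "a \<in> {i. (0, 0, 2 * i) \<in> D}" "b \<in> {i. (0, 0, 2 * i) \<in> D}" for a b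
      using that diff[of "(0, 0, 2 * a)" "(0, 0, 2 * b)"] by (simp add: right_diff_distrib)
    show "i3 - i3' \<in> {i. (0, 0, 2 * i) \<in> D}" "i3 - i3' \<noteq> 0" using i3 by (auto simp: right_diff_distrib)
  qed auto
  \<comment> \<open>The square of the first element is the translation by \<open>2 * k\<close> along
    the first axis; so \<open>p\<close> divides the odd number \<open>k\<close>.\<close>
  have "(2 * k, 0, 0) \<in> D" using mult[OF x(1) x(1)] x by (simp add: par_odd)
  then have pk: "p dvd k" using p(2) by blast
  then have "odd p" using x(2) by (auto dest: dvd_trans)
  have "(0, 2 * m, 0) \<in> D" using mult[OF y(1) y(1)] y by (simp add: par_odd)
  then have qm: "q dvd m" using q(2) by blast
  then have "odd q" using y(3) by (auto dest: dvd_trans)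
  \<comment> \<open>The product has the third nontrivial parity pattern. Its square shows that
    \<open>r\<close> is odd and links \<open>\<beta>\<close> to \<open>\<delta>\<close> through
    \<open>rd\<close>.\<close>
  have xy: "(k + \<gamma>, \<alpha> - m, \<beta> - \<delta>) \<in> D" using mult[OF x(1) y(1)] x y by (simp add: par_odd)
  have "(0, 0, 2 * (\<beta> - \<delta>)) \<in> D" using mult[OF xy xy] x y by (simp add: par_odd)
  then have rd: "r dvd \<beta> - \<delta>" using r(2) by blast
  then have "odd r" using x(4) y(4) by (auto dest: dvd_trans)
  note odd = \<open>odd p\<close> \<open>odd q\<close> \<open>odd r\<close>
  have even_mem: "(2 * a, 2 * b, 2 * c) \<in> D \<longleftrightarrow> p dvd a \<and> q dvd b \<and> r dvd c" for a b c
  proof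
    assume t: "(2 * a, 2 * b, 2 * c) \<in> D"
    \<comment> \<open>Conjugation by this element keeps the first coordinate of the translation and
      negates the others; after multiplication by the translation only the first survives,
      doubled.\<close>
    have "(k, \<alpha>, \<beta>) \<otimes>\<^bsub>hw\<^esub> (2 * a, 2 * b, 2 * c) \<otimes>\<^bsub>hw\<^esub> inv\<^bsub>hw\<^esub> (k, \<alpha>, \<beta>) \<otimes>\<^bsub>hw\<^esub> (2 * a, 2 * b, 2 * c) \<in> D"
      by (rule mult[OF diff[OF mult[OF x(1) t] x(1)] t])
    then have "(2 * (2 * a), 0, 0) \<in> D" using x by (simp add: par_odd)
    then have 1: "p dvd a" using odd p(2) odd_dvd_double by blast
    have "(\<gamma>, m, \<delta>) \<otimes>\<^bsub>hw\<^esub> (2 * a, 2 * b, 2 * c) \<otimes>\<^bsub>hw\<^esub> inv\<^bsub>hw\<^esub> (\<gamma>, m, \<delta>) \<otimes>\<^bsub>hw\<^esub> (2 * a, 2 * b, 2 * c) \<in> D"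
      by (rule mult[OF diff[OF mult[OF y(1) t] y(1)] t])
    then have "(0, 2 * (2 * b), 0) \<in> D" using y by (simp add: par_odd)
    then have 2: "q dvd b" using odd q(2) odd_dvd_double by blast
    have a: "(2 * a, 0, 0) \<in> D" and b: "(0, 2 * b, 0) \<in> D" using 1 2 p(2) q(2) by simp_all
    have "(0, 0, 2 * c) \<in> D" using diff[OF diff[OF t a] b] by simp
    then show "p dvd a \<and> q dvd b \<and> r dvd c" using 1 2 r(2) by blast
  next
    assume "p dvd a \<and> q dvd b \<and> r dvd c"
    then have "(2 * a, 0, 0) \<in> D" "(0, 2 * b, 0) \<in> D" "(0, 0, 2 * c) \<in> D"
      using p(2) q(2) r(2) by simp_all
    then show "(2 * a, 2 * b, 2 * c) \<in> D" using mult[OF mult] by fastforce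
  qed
  \<comment> \<open>A left factor with even coordinates multiplies without signs.\<close>
  have shift: "(a + a', b + b', c + c') \<in> D"
    if s: "even a" "even b" "even c" "p dvd a" "q dvd b" "r dvd c" "(a', b', c') \<in> D" for a b c a' b' c'
  proof -
    obtain a1 b1 c1 where "a = 2 * a1" "b = 2 * b1" "c = 2 * c1" using s(1-3) by (metis evenE)
    then show ?thesis
      using mult[OF _ s(7), of "(a, b, c)"] even_mem[of a1 b1 c1] s odd
      by (simp add: odd_dvd_double)
  qed
  \<comment> \<open>The generators should go to \<open>(p, q + 2 * v, 2 * w)\<close> and
    \<open>(2 * u, q, r + 2 * w)\<close>. Modulo the sides, \<open>2 * u\<close> has to match
    \<open>\<gamma>\<close>, \<open>q + 2 * v\<close> has to match \<open>\<alpha>\<close>, and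
    \<open>2 * w\<close> has to match \<open>\<beta>\<close>; the halving is exact, as
    \<open>\<alpha>\<close> and \<open>q\<close> are both odd.\<close>
  define u where "u = (\<gamma> div 2) mod p"
  define v where "v = ((\<alpha> - q) div 2) mod q"
  define w where "w = (\<beta> div 2) mod r"
  have half: "d dvd 2 * (n div 2 mod d) - n" if "even n" for d n :: int
  proof -
    obtain h where n: "n = 2 * h" using \<open>even n\<close> by (rule evenE)
    have "d dvd h mod d - h" by (simp flip: mod_eq_dvd_iff)
    then have "d dvd 2 * (h mod d - h)" by (rule dvd_mult)
    then show ?thesis by (simp add: n right_diff_distrib)
  qed
  have ud: "p dvd 2 * u - \<gamma>" and wd: "r dvd 2 * w - \<beta>" using half x y by (simp_all add: u_def w_def)
  have vd: "q dvd q + 2 * v - \<alpha>" using half[of "\<alpha> - q" q] x odd by (simp add: v_def algebra_simps)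
  define \<phi> where "\<phi> = hw_emb p q r u v w"
  interpret \<phi>: group_hom hw hw \<phi>
    unfolding \<phi>_def by unfold_locales (rule hw_emb_hom[OF odd])
  have acc: "acc True 0 = 0" "acc True 1 = 1" by (simp_all add: acc_def)
  have "\<phi> (1, 1, 0) \<in> D"
    using shift[of "p - k" "q + 2 * v - \<alpha>" "2 * w - \<beta>" k \<alpha> \<beta>] x odd pk vd wd by (simp add: \<phi>_def acc)
  moreover have "\<phi> (0, 1, 1) \<in> D"
  proof -
    \<comment> \<open>\<open>w\<close> was fitted to \<open>\<beta>\<close>; that it suits
      \<open>\<delta>\<close> as well is the divisibility \<open>rd\<close> gained from the product
      of the two elements.\<close>
    have "r dvd (2 * w - \<beta>) + (r + (\<beta> - \<delta>))" by (intro dvd_add dvd_refl wd rd)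
    then have "r dvd r + 2 * w - \<delta>" by (simp add: algebra_simps)
    then show ?thesis
      using shift[of "2 * u - \<gamma>" "q - m" "r + 2 * w - \<delta>" \<gamma> m \<delta>] y odd ud qm by (simp add: \<phi>_def acc)
  qed
  ultimately have \<phi>D: "\<phi> t \<in> D" if "t \<in> carrier hw" for t
    using hw_generated[OF \<phi>.subgroup_preimage[OF D] _ _ that] by simp
  have "D \<subseteq> \<phi> ` carrier hw"
  proof
    fix t assume t: "t \<in> D"
    then have tc: "t \<in> carrier hw" using subgroup.mem_carrier[OF D] by blast
    obtain a b c where abc: "t = (a, b, c)" by (cases t)
    have "t \<otimes>\<^bsub>hw\<^esub> inv\<^bsub>hw\<^esub> (\<phi> t) \<in> D" by (rule diff[OF t \<phi>D[OF tc]])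
    moreover have "t \<otimes>\<^bsub>hw\<^esub> inv\<^bsub>hw\<^esub> (\<phi> t) \<in> Lat"
      using tc odd by (simp add: abc \<phi>_def Lat_def)
    moreover obtain a1 b1 c1 where 1: "t \<otimes>\<^bsub>hw\<^esub> inv\<^bsub>hw\<^esub> (\<phi> t) = (2 * a1, 2 * b1, 2 * c1)"
      using calculation(2) by (auto simp: Lat_def elim!: evenE)
    ultimately have "p dvd a1" "q dvd b1" "r dvd c1" using even_mem by metis+
    then obtain a2 b2 c2 where "a1 = p * a2" "b1 = q * b2" "c1 = r * c2" by (auto simp: dvd_def)
    then have 2: "\<phi> (2 * a2, 2 * b2, 2 * c2) = (2 * a1, 2 * b1, 2 * c1)"
      by (simp add: \<phi>_def acc_even_odd)
    have "t = t \<otimes>\<^bsub>hw\<^esub> inv\<^bsub>hw\<^esub> (\<phi> t) \<otimes>\<^bsub>hw\<^esub> \<phi> t" using tc by (simp add: hw.m_assoc)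
    also have "\<dots> = \<phi> ((2 * a2, 2 * b2, 2 * c2) \<otimes>\<^bsub>hw\<^esub> t)"
      using tc unfolding 1 2[symmetric] by (intro \<phi>.hom_mult[symmetric]) auto
    finally show "t \<in> \<phi> ` carrier hw"
      using tc by (metis (no_types) hw.m_closed hw_simps(1) even_add dvd_triv_left image_eqI)
  qed
  with \<phi>D have "D = \<phi> ` carrier hw" by blast
  then show ?thesis
    using that[of p q r u v w] odd p(1) q(1) r(1) by (simp add: \<phi>_def u_def v_def w_def)
qed

text \<open>An element outside \<open>Axis m\<close> lies in one of two nontrivial parity classes.
  Taken over all three \<open>m\<close>, at least two of these classes meet \<open>D\<close>, and a
  product from them lies in the third.\<close>

lemma not_axes_cases:
  assumes D: "subgroup D hw" and not: "\<not> D \<subseteq> Axis 0" "\<not> D \<subseteq> Axis 1" "\<not> D \<subseteq> Axis 2"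
  obtains k \<alpha> \<beta> \<gamma> m \<delta> where "(k, \<alpha>, \<beta>) \<in> D" "odd k" "odd \<alpha>" "even \<beta>"
    "(\<gamma>, m, \<delta>) \<in> D" "even \<gamma>" "odd m" "odd \<delta>"
proof -
  note mult = subgroup.m_closed[OF D]
  have car: "even (a + b + c)" if "(a, b, c) \<in> D" for a b c
    using subgroup.mem_carrier[OF D that] by simp
  define hasx where "hasx \<longleftrightarrow> (\<exists>a b c. (a, b, c) \<in> D \<and> odd a \<and> odd b \<and> even c)"
  define hasy where "hasy \<longleftrightarrow> (\<exists>a b c. (a, b, c) \<in> D \<and> even a \<and> odd b \<and> odd c)"
  define hasz where "hasz \<longleftrightarrow> (\<exists>a b c. (a, b, c) \<in> D \<and> odd a \<and> even b \<and> odd c)"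
  obtain a b c where "(a, b, c) \<in> D" "(a, b, c) \<notin> Axis 0" using not(1) by (auto simp: subset_iff)
  then have "(a, b, c) \<in> D" "odd c" using car[of a b c] by (simp_all add: Axis_def)
  then have yz: "hasy \<or> hasz" unfolding hasy_def hasz_def using car by (metis even_add)
  obtain a b c where "(a, b, c) \<in> D" "(a, b, c) \<notin> Axis 1" using not(2) by (auto simp: subset_iff)
  then have "(a, b, c) \<in> D" "odd a" using car[of a b c] by (simp_all add: Axis_def)
  then have xz: "hasx \<or> hasz" unfolding hasx_def hasz_def using car by (metis even_add)
  obtain a b c where "(a, b, c) \<in> D" "(a, b, c) \<notin> Axis 2" using not(3) by (auto simp: subset_iff)
  then have "(a, b, c) \<in> D" "odd b" using car[of a b c] by (simp_all add: Axis_def)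
  then have xy: "hasx \<or> hasy" unfolding hasx_def hasy_def using car by (metis even_add)
  have "hasx" if hasy hasz
  proof -
    obtain a b c a' b' c' where "(a, b, c) \<in> D" "even a" "odd b" "odd c"
      "(a', b', c') \<in> D" "odd a'" "even b'" "odd c'"
      using \<open>hasy\<close> \<open>hasz\<close> unfolding hasy_def hasz_def by blast
    then show ?thesis using mult[of "(a, b, c)" "(a', b', c')"] unfolding hasx_def by fastforce
  qed
  moreover have "hasy" if hasx hasz
  proof -
    obtain a b c a' b' c' where "(a, b, c) \<in> D" "odd a" "odd b" "even c"
      "(a', b', c') \<in> D" "odd a'" "even b'" "odd c'"
      using \<open>hasx\<close> \<open>hasz\<close> unfolding hasx_def hasz_def by blast
    then show ?thesis using mult[of "(a, b, c)" "(a', b', c')"] unfolding hasy_def by fastforce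
  qed
  ultimately have "hasx \<and> hasy" using yz xz xy by blast
  then show ?thesis using that unfolding hasx_def hasy_def by blast
qed

definition full_subgroups :: "nat \<Rightarrow> (int \<times> int \<times> int) set set" where
  "full_subgroups n = {\<Delta>. subgroup \<Delta> hw \<and> \<not> \<Delta> \<subseteq> Axis 0 \<and> \<not> \<Delta> \<subseteq> Axis 1 \<and> \<not> \<Delta> \<subseteq> Axis 2 \<and>
    card (rcosets\<^bsub>hw\<^esub> \<Delta>) = n}"

definition odd_triples :: "rat \<Rightarrow> (nat \<times> nat \<times> nat) set" where
  "odd_triples q = {(a, b, c). (a, b, c) \<in> factor_triples q \<and> odd a \<and> odd b \<and> odd c}"

lemma full_subgroup_emb:
  assumes "\<Delta> \<in> full_subgroups n" "n > 0"
  obtains p q r u v w where "odd p" "odd q" "odd r" "p > 0" "q > 0" "r > 0"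
    "0 \<le> u" "u < p" "0 \<le> v" "v < q" "0 \<le> w" "w < r" "\<Delta> = hw_emb p q r u v w ` carrier hw"
proof -
  have D: "subgroup \<Delta> hw" "\<not> \<Delta> \<subseteq> Axis 0" "\<not> \<Delta> \<subseteq> Axis 1" "\<not> \<Delta> \<subseteq> Axis 2"
    and c: "card (rcosets\<^bsub>hw\<^esub> \<Delta>) = n" using assms by (simp_all add: full_subgroups_def)
  have fin: "finite (rcosets\<^bsub>hw\<^esub> \<Delta>)" using c assms(2) card.infinite by fastforce
  obtain k \<alpha> \<beta> \<gamma> m \<delta> where xy: "(k, \<alpha>, \<beta>) \<in> \<Delta>" "odd k" "odd \<alpha>" "even \<beta>"
    "(\<gamma>, m, \<delta>) \<in> \<Delta>" "even \<gamma>" "odd m" "odd \<delta>" by (rule not_axes_cases[OF D])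
  show ?thesis by (rule hw_full_subgroup[OF D(1) fin xy]) (rule that)
qed

lemma full_subgroup_iso:
  assumes "\<Delta> \<in> full_subgroups n" "n > 0"
  shows "hw\<lparr>carrier := \<Delta>\<rparr> \<cong> hw"
proof -
  obtain p q r u v w where "odd p" "odd q" "odd r" and \<Delta>: "\<Delta> = hw_emb p q r u v w ` carrier hw"
    by (rule full_subgroup_emb[OF assms])
  then show ?thesis
    using group.image_iso[OF group_hw group_hw hw_emb_hom] hw_emb_inj inj_on_subset[OF hw_emb_inj]
    by simp
qed

text \<open>Every odd triple with product \<open>n\<close> allows exactly \<open>n\<close> offsets,
  whence the factor \<open>int n\<close>.\<close>

lemma full_subgroups_card:
  assumes n: "n > 0"
  shows "finite (full_subgroups n)"
    and "int (card (full_subgroups n)) = int n * int (card (odd_triples (of_nat n)))"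
proof -
  define B where "B = (\<lambda>(p :: nat, q :: nat, r :: nat). {0..<int p} \<times> {0..<int q} \<times> {0..<int r})"
  define F where "F = (\<lambda>((p, q, r), (u, v, w)). hw_emb (int p) (int q) (int r) u v w ` carrier hw)"
  define S where "S = Sigma (odd_triples (of_nat n)) B"
  have "odd_triples (of_nat n) \<subseteq> factor_triples (of_nat n)" by (auto simp: odd_triples_def)
  then have finO: "finite (odd_triples (of_nat n))" by (rule finite_subset) (rule finite_factor_triples)
  have mem: "(p, q, r) \<in> odd_triples (of_nat n) \<longleftrightarrow> odd p \<and> odd q \<and> odd r \<and> p * q * r = n" for p q r
    using n by (auto simp: odd_triples_def factor_triples_def simp flip: of_nat_mult
        intro!: Nat.gr0I)
  have bij: "bij_betw F S (full_subgroups n)"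
  proof (rule bij_betw_imageI)
    show "inj_on F S"
    proof (rule inj_onI)
      fix s t assume s: "s \<in> S" and t: "t \<in> S" and eq: "F s = F t"
      obtain p q r u v w p' q' r' u' v' w'
        where st: "s = ((p, q, r), (u, v, w))" "t = ((p', q', r'), (u', v', w'))"
        by (cases s; cases t) auto
      show "s = t"
        using hw_emb_image_inj[of "int p" "int q" "int r" u v w "int p'" "int q'" "int r'" u' v' w']
          s t eq by (simp add: st F_def B_def S_def mem)
    qed
    show "F ` S = full_subgroups n"
    proof
      show "F ` S \<subseteq> full_subgroups n"
      proof
        fix \<Delta> assume "\<Delta> \<in> F ` S"
        then obtain p q r u v w where pqr: "odd p" "odd q" "odd r" "p * q * r = n"
          and \<Delta>: "\<Delta> = hw_emb (int p) (int q) (int r) u v w ` carrier hw"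
          by (auto simp: S_def F_def mem)
        let ?f = "hw_emb (int p) (int q) (int r) u v w"
        have pos: "p > 0" "q > 0" "r > 0" using pqr n by (auto intro!: Nat.gr0I)
        have "?f (1, 1, 0) \<in> \<Delta>" "?f (0, 1, 1) \<in> \<Delta>"
          unfolding \<Delta> by (rule imageI, simp)+
        moreover have "?f (1, 1, 0) \<notin> Axis 1" "?f (1, 1, 0) \<notin> Axis 2" "?f (0, 1, 1) \<notin> Axis 0"
          using pqr by (simp_all add: Axis_def)
        ultimately have "\<not> \<Delta> \<subseteq> Axis 0" "\<not> \<Delta> \<subseteq> Axis 1" "\<not> \<Delta> \<subseteq> Axis 2" by blast+
        moreover have "subgroup \<Delta> hw" "card (rcosets\<^bsub>hw\<^esub> \<Delta>) = n"
          unfolding \<Delta> using subgroup_hw_emb card_rcosets_hw_emb pqr pos by simp_all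
        ultimately show "\<Delta> \<in> full_subgroups n" by (simp add: full_subgroups_def)
      qed
      show "full_subgroups n \<subseteq> F ` S"
      proof
        fix \<Delta> assume \<Delta>: "\<Delta> \<in> full_subgroups n"
        obtain p q r u v w where odd: "odd p" "odd q" "odd r" and pos: "p > 0" "q > 0" "r > 0"
          and bd: "0 \<le> u" "u < p" "0 \<le> v" "v < q" "0 \<le> w" "w < r"
          and im: "\<Delta> = hw_emb p q r u v w ` carrier hw"
          by (rule full_subgroup_emb[OF \<Delta> n])
        have "nat p * nat q * nat r = n"
          using \<Delta> card_rcosets_hw_emb[OF odd pos] by (simp add: full_subgroups_def im)
        then have "((nat p, nat q, nat r), (u, v, w)) \<in> S"
          using odd pos bd by (simp add: S_def mem B_def even_nat_iff)
        moreover have "\<Delta> = F ((nat p, nat q, nat r), (u, v, w))" using pos by (simp add: F_def im)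
        ultimately show "\<Delta> \<in> F ` S" by blast
      qed
    qed
  qed
  have finB: "finite (B t)" for t by (cases t) (simp add: B_def)
  show "finite (full_subgroups n)"
    using bij_betw_finite[OF bij] finO finB by (simp add: S_def)
  have "card (B t) = n" if "t \<in> odd_triples (of_nat n)" for t
    using that by (cases t) (simp add: B_def mem mult.assoc)
  then have "card S = card (odd_triples (of_nat n)) * n"
    by (simp add: S_def finO finB)
  then show "int (card (full_subgroups n)) = int n * int (card (odd_triples (of_nat n)))"
    using bij_betw_same_card[OF bij] by simp
qed

text \<open>\<open>D\<close> stands for doubling the coordinate \<open>co\<close>: it matches the
  triples for q/2 with the triples for q in which \<open>co\<close> is even. The condition
  \<open>P\<close>, invariant under \<open>D\<close>, allows the step to be repeated for another
  coordinate.\<close>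

lemma card_odd_coordinate:
  fixes D :: "nat \<times> nat \<times> nat \<Rightarrow> nat \<times> nat \<times> nat"
  assumes "inj D" and even: "\<And>t. even (co t) \<longleftrightarrow> t \<in> range D"
    and half: "\<And>t. D t \<in> factor_triples q \<longleftrightarrow> t \<in> factor_triples (q / 2)"
    and P: "\<And>t. P (D t) \<longleftrightarrow> P t"
  shows "int (card {t \<in> factor_triples q. odd (co t :: nat) \<and> P t}) =
    int (card {t \<in> factor_triples q. P t}) - int (card {t \<in> factor_triples (q / 2). P t})"
proof -
  have "bij_betw D {t \<in> factor_triples (q / 2). P t} {t \<in> factor_triples q. even (co t) \<and> P t}"
    using inj_on_subset[OF \<open>inj D\<close>] by (intro bij_betw_imageI) (auto simp: even half P)
  then have 1: "card {t \<in> factor_triples q. even (co t) \<and> P t} = card {t \<in> factor_triples (q / 2). P t}"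
    by (rule bij_betw_same_card[symmetric])
  have "{t \<in> factor_triples q. P t} =
      {t \<in> factor_triples q. odd (co t) \<and> P t} \<union> {t \<in> factor_triples q. even (co t) \<and> P t}"
    by auto
  then have "card {t \<in> factor_triples q. P t} =
      card {t \<in> factor_triples q. odd (co t) \<and> P t} + card {t \<in> factor_triples q. even (co t) \<and> P t}"
    by (simp only:) (rule card_Un_disjoint, auto simp: finite_factor_triples)
  with 1 show ?thesis by simp
qed

text \<open>Discarding the even values of one coordinate replaces g(q) by g(q) - g(q/2). Three
  rounds apply the cube of this operator to \<open>d3\<close>, hence the coefficients 1, -3, 3,
  -1.\<close>

lemma card_odd_triples:
  "int (card (odd_triples q)) = d3 q - 3 * d3 (q / 2) + 3 * d3 (q / 4) - d3 (q / 8)"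
proof -
  let ?a = "\<lambda>t :: nat \<times> nat \<times> nat. fst t"
    and ?b = "\<lambda>t :: nat \<times> nat \<times> nat. fst (snd t)"
    and ?c = "\<lambda>t :: nat \<times> nat \<times> nat. snd (snd t)"
  have d3: "int (card {t \<in> factor_triples q. True}) = d3 q" for q by (simp add: d3_def split_def)
  have half: "x = q / 2 \<longleftrightarrow> 2 * x = q" for x q :: rat by auto
  have a: "int (card {t \<in> factor_triples q. odd (?a t) \<and> P t}) =
      int (card {t \<in> factor_triples q. P t}) - int (card {t \<in> factor_triples (q / 2). P t})"
    if "\<And>a b c. P (2 * a, b, c) \<longleftrightarrow> P (a, b, c)" for P q
    by (rule card_odd_coordinate[where D = "\<lambda>(a, b, c). (2 * a, b, c)"])
      (auto simp: inj_def factor_triples_def image_iff half that mult.assoc mult.left_commute elim!: evenE)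
  have b: "int (card {t \<in> factor_triples q. odd (?b t) \<and> P t}) =
      int (card {t \<in> factor_triples q. P t}) - int (card {t \<in> factor_triples (q / 2). P t})"
    if "\<And>a b c. P (a, 2 * b, c) \<longleftrightarrow> P (a, b, c)" for P q
    by (rule card_odd_coordinate[where D = "\<lambda>(a, b, c). (a, 2 * b, c)"])
      (auto simp: inj_def factor_triples_def image_iff half that mult.assoc mult.left_commute elim!: evenE)
  have c: "int (card {t \<in> factor_triples q. odd (?c t) \<and> P t}) =
      int (card {t \<in> factor_triples q. P t}) - int (card {t \<in> factor_triples (q / 2). P t})"
    if "\<And>a b c. P (a, b, 2 * c) \<longleftrightarrow> P (a, b, c)" for P q
    by (rule card_odd_coordinate[where D = "\<lambda>(a, b, c). (a, b, 2 * c)"])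
      (auto simp: inj_def factor_triples_def image_iff half that mult.assoc mult.left_commute elim!: evenE)
  have 1: "int (card {t \<in> factor_triples q. odd (?c t)}) = d3 q - d3 (q / 2)" for q
    using c[of "\<lambda>_. True" q] unfolding d3 by simp
  have 2: "int (card {t \<in> factor_triples q. odd (?b t) \<and> odd (?c t)}) =
      d3 q - 2 * d3 (q / 2) + d3 (q / 4)" for q
    using b[of "\<lambda>t. odd (?c t)" q] unfolding 1 by simp
  have a: "int (card {t \<in> factor_triples q. odd (?a t) \<and> odd (?b t) \<and> odd (?c t)}) =
      d3 q - 3 * d3 (q / 2) + 3 * d3 (q / 4) - d3 (q / 8)"
    using a[of "\<lambda>t. odd (?b t) \<and> odd (?c t)" q] unfolding 2 by simp
  have "odd_triples q = {t \<in> factor_triples q. odd (?a t) \<and> odd (?b t) \<and> odd (?c t)}"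
    by (auto simp: odd_triples_def)
  with a show ?thesis by simp
qed

section \<open>Counting the subgroups\<close>

lemma hw_subgroup_cases:
  assumes "subgroup \<Delta> hw" "card (rcosets\<^bsub>hw\<^esub> \<Delta>) = n"
  obtains "\<Delta> \<in> Lat_subgroups n" | "\<Delta> \<in> (\<Union>m<3. Axis_subgroups m n - Lat_subgroups n)"
  | "\<Delta> \<in> full_subgroups n"
proof -
  have "m < 3 \<longleftrightarrow> m = 0 \<or> m = 1 \<or> m = 2" for m :: nat by auto
  then show ?thesis
    using assms that unfolding Lat_subgroups_def Axis_subgroups_def full_subgroups_def by auto
qed

lemma hw_subgroup_isos:
  assumes "n > 0"
  shows "\<Delta> \<in> Lat_subgroups n \<Longrightarrow> hw\<lparr>carrier := \<Delta>\<rparr> \<cong> semi False"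
    and "\<Delta> \<in> (\<Union>m<3. Axis_subgroups m n - Lat_subgroups n) \<Longrightarrow> hw\<lparr>carrier := \<Delta>\<rparr> \<cong> semi True"
    and "\<Delta> \<in> full_subgroups n \<Longrightarrow> hw\<lparr>carrier := \<Delta>\<rparr> \<cong> hw"
proof -
  show "hw\<lparr>carrier := \<Delta>\<rparr> \<cong> semi False" if "\<Delta> \<in> Lat_subgroups n"
    using Lat_subgroups(3)[OF assms that] .
  show "hw\<lparr>carrier := \<Delta>\<rparr> \<cong> hw" if "\<Delta> \<in> full_subgroups n"
    using full_subgroup_iso[OF that assms] .
  assume "\<Delta> \<in> (\<Union>m<3. Axis_subgroups m n - Lat_subgroups n)"
  then obtain m where "m < 3" "\<Delta> \<in> Axis_subgroups m n" "\<Delta> \<notin> Lat_subgroups n" by auto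
  moreover from this have "\<not> \<Delta> \<subseteq> Lat" by (auto simp: Lat_subgroups_def Axis_subgroups_def)
  ultimately show "hw\<lparr>carrier := \<Delta>\<rparr> \<cong> semi True" using Axis_subgroups(3)[OF assms] by blast
qed

text \<open>The three classes exhaust the subgroups of index \<open>n\<close>, each class has a
  single isomorphism type, and the types are pairwise non-isomorphic; so a subgroup of a given type
  cannot lie in another class.\<close>

lemma hw_subgroups_iso:
  assumes n: "n > 0"
  shows "subgroups_iso (semi False) hw n = Lat_subgroups n"
    and "subgroups_iso (semi True) hw n = (\<Union>m<3. Axis_subgroups m n - Lat_subgroups n)"
    and "subgroups_iso hw hw n = full_subgroups n"
proof -
  have sub: "subgroup \<Delta> hw \<and> card (rcosets\<^bsub>hw\<^esub> \<Delta>) = n"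
    if "\<Delta> \<in> Lat_subgroups n \<union> (\<Union>m<3. Axis_subgroups m n - Lat_subgroups n) \<union> full_subgroups n" for \<Delta>
    using that by (auto simp: Lat_subgroups_def Axis_subgroups_def full_subgroups_def)
  have iso: "K \<cong> K'" if "subgroup \<Delta> hw" "hw\<lparr>carrier := \<Delta>\<rparr> \<cong> K" "hw\<lparr>carrier := \<Delta>\<rparr> \<cong> K'"
    for \<Delta> :: "(int \<times> int \<times> int) set" and K K' :: "(int \<times> int \<times> int) monoid"
    using group.iso_sym[OF subgroup.subgroup_is_group[OF that(1) group_hw] that(2)] that(3)
    by (rule iso_trans)
  have not: "\<not> semi False \<cong> semi True" "\<not> semi False \<cong> hw" "\<not> semi True \<cong> hw"
    "\<not> semi True \<cong> semi False" "\<not> hw \<cong> semi False" "\<not> hw \<cong> semi True"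
    using semi_True_not_iso_False hw_not_iso_False hw_not_iso_True group.iso_sym[OF group_semi]
    by blast+
  note isos = hw_subgroup_isos[OF n]
  show "subgroups_iso (semi False) hw n = Lat_subgroups n"
  proof (intro equalityI subsetI)
    fix \<Delta> assume "\<Delta> \<in> subgroups_iso (semi False) hw n"
    then have \<Delta>: "subgroup \<Delta> hw" "card (rcosets\<^bsub>hw\<^esub> \<Delta>) = n" "hw\<lparr>carrier := \<Delta>\<rparr> \<cong> semi False"
      by (simp_all add: subgroups_iso_def)
    from \<Delta>(1,2) show "\<Delta> \<in> Lat_subgroups n"
    proof (cases rule: hw_subgroup_cases)
      case 2
      then show ?thesis using iso[OF \<Delta>(1,3) isos(2)] not by blast
    next
      case 3
      then show ?thesis using iso[OF \<Delta>(1,3) isos(3)] not by blast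
    qed
  qed (use sub isos(1) in \<open>auto simp: subgroups_iso_def\<close>)
  show "subgroups_iso (semi True) hw n = (\<Union>m<3. Axis_subgroups m n - Lat_subgroups n)"
  proof (intro equalityI subsetI)
    fix \<Delta> assume "\<Delta> \<in> subgroups_iso (semi True) hw n"
    then have \<Delta>: "subgroup \<Delta> hw" "card (rcosets\<^bsub>hw\<^esub> \<Delta>) = n" "hw\<lparr>carrier := \<Delta>\<rparr> \<cong> semi True"
      by (simp_all add: subgroups_iso_def)
    from \<Delta>(1,2) show "\<Delta> \<in> (\<Union>m<3. Axis_subgroups m n - Lat_subgroups n)"
    proof (cases rule: hw_subgroup_cases)
      case 1
      then show ?thesis using iso[OF \<Delta>(1,3) isos(1)] not by blast
    next
      case 3
      then show ?thesis using iso[OF \<Delta>(1,3) isos(3)] not by blast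
    qed
  next
    fix \<Delta> assume "\<Delta> \<in> (\<Union>m<3. Axis_subgroups m n - Lat_subgroups n)"
    then show "\<Delta> \<in> subgroups_iso (semi True) hw n"
      using sub[of \<Delta>] isos(2)[of \<Delta>] by (simp add: subgroups_iso_def)
  qed
  show "subgroups_iso hw hw n = full_subgroups n"
  proof (intro equalityI subsetI)
    fix \<Delta> assume "\<Delta> \<in> subgroups_iso hw hw n"
    then have \<Delta>: "subgroup \<Delta> hw" "card (rcosets\<^bsub>hw\<^esub> \<Delta>) = n" "hw\<lparr>carrier := \<Delta>\<rparr> \<cong> hw"
      by (simp_all add: subgroups_iso_def)
    from \<Delta>(1,2) show "\<Delta> \<in> full_subgroups n"
    proof (cases rule: hw_subgroup_cases)
      case 1
      then show ?thesis using iso[OF \<Delta>(1,3) isos(1)] not by blast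
    next
      case 2
      then show ?thesis using iso[OF \<Delta>(1,3) isos(2)] not by blast
    qed
  qed (use sub isos(3) in \<open>auto simp: subgroups_iso_def\<close>)
qed

theorem theorem1:
  "(\<forall>\<Delta>. subgroup \<Delta> pi1_G6 \<and> finite (rcosets\<^bsub>pi1_G6\<^esub> \<Delta>) \<longrightarrow>
      pi1_G6\<lparr>carrier := \<Delta>\<rparr> \<cong> pi1_G6 \<or>
      pi1_G6\<lparr>carrier := \<Delta>\<rparr> \<cong> pi1_G2 \<or>
      pi1_G6\<lparr>carrier := \<Delta>\<rparr> \<cong> pi1_G1) \<and>
   (\<forall>n::nat. n > 0 \<longrightarrow>
      finite (subgroups_iso pi1_G1 pi1_G6 n) \<and>
      finite (subgroups_iso pi1_G2 pi1_G6 n) \<and>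
      finite (subgroups_iso pi1_G6 pi1_G6 n) \<and>
      int (card (subgroups_iso pi1_G1 pi1_G6 n)) = omega (of_nat n / 4) \<and>
      int (card (subgroups_iso pi1_G2 pi1_G6 n)) =
        3 * omega (of_nat n / 2) - 3 * omega (of_nat n / 4) \<and>
      int (card (subgroups_iso pi1_G6 pi1_G6 n)) =
        int n * (d3 (of_nat n) - 3 * d3 (of_nat n / 2)
                 + 3 * d3 (of_nat n / 4) - d3 (of_nat n / 8)))"
proof -
  have G6: "group pi1_G6" and G2: "group pi1_G2"
    by (simp_all add: pi1_G6_def pi1_G2_def group_presented_group)
  obtain \<psi> where \<psi>: "\<psi> \<in> iso pi1_G6 hw" using pi1_G6_iso by (auto simp: is_iso_def)
  have bij: "bij_betw ((`) \<psi>) (subgroups_iso pi1_G1 pi1_G6 n) (subgroups_iso (semi False) hw n)"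
    "bij_betw ((`) \<psi>) (subgroups_iso pi1_G2 pi1_G6 n) (subgroups_iso (semi True) hw n)"
    "bij_betw ((`) \<psi>) (subgroups_iso pi1_G6 pi1_G6 n) (subgroups_iso hw hw n)" for n
    unfolding pi1_G1_eq
    by (intro bij_betw_subgroups_iso[OF G6 group_hw \<psi>] group_semi iso_refl G2 G6 pi1_G2_iso pi1_G6_iso)+
  have counts: "finite (subgroups_iso pi1_G1 pi1_G6 n) \<and>
      finite (subgroups_iso pi1_G2 pi1_G6 n) \<and>
      finite (subgroups_iso pi1_G6 pi1_G6 n) \<and>
      int (card (subgroups_iso pi1_G1 pi1_G6 n)) = omega (of_nat n / 4) \<and>
      int (card (subgroups_iso pi1_G2 pi1_G6 n)) =
        3 * omega (of_nat n / 2) - 3 * omega (of_nat n / 4) \<and>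
      int (card (subgroups_iso pi1_G6 pi1_G6 n)) =
        int n * (d3 (of_nat n) - 3 * d3 (of_nat n / 2)
                 + 3 * d3 (of_nat n / 4) - d3 (of_nat n / 8))" if n: "n > 0" for n
    unfolding bij_betw_finite[OF bij(1)] bij_betw_finite[OF bij(2)] bij_betw_finite[OF bij(3)]
      bij_betw_same_card[OF bij(1)] bij_betw_same_card[OF bij(2)] bij_betw_same_card[OF bij(3)]
      hw_subgroups_iso[OF n] card_odd_triples[symmetric]
    using Lat_subgroups(1,2)[OF n] card_Axis_not_Lat[OF n] full_subgroups_card[OF n] by blast
  have "pi1_G6\<lparr>carrier := \<Delta>\<rparr> \<cong> pi1_G6 \<or> pi1_G6\<lparr>carrier := \<Delta>\<rparr> \<cong> pi1_G2 \<or>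
      pi1_G6\<lparr>carrier := \<Delta>\<rparr> \<cong> pi1_G1"
    if \<Delta>: "subgroup \<Delta> pi1_G6" and fin: "finite (rcosets\<^bsub>pi1_G6\<^esub> \<Delta>)" for \<Delta>
  proof -
    interpret \<psi>: group_hom pi1_G6 hw \<psi>
      using \<psi> G6 group_hw by (simp add: group_hom_def group_hom_axioms_def iso_def)
    have inj: "inj_on \<psi> (carrier pi1_G6)" using \<psi> by (simp add: iso_def bij_betw_def)
    \<comment> \<open>The classification is stated for a positive index: the set of cosets is finite
      and nonempty, and \<open>\<psi>\<close> preserves its size.\<close>
    define n where "n = card (rcosets\<^bsub>hw\<^esub> (\<psi> ` \<Delta>))"
    have "n = card (rcosets\<^bsub>pi1_G6\<^esub> \<Delta>)" unfolding n_def by (rule card_rcosets_iso[OF G6 group_hw \<psi> \<Delta>])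
    moreover have "rcosets\<^bsub>pi1_G6\<^esub> \<Delta> \<noteq> {}" using \<psi>.G.one_closed unfolding RCOSETS_def by blast
    ultimately have n: "n > 0" using fin by (simp add: card_gt_0_iff)
    have iso: "pi1_G6\<lparr>carrier := \<Delta>\<rparr> \<cong> hw\<lparr>carrier := \<psi> ` \<Delta>\<rparr>" by (rule \<psi>.restrict_iso[OF inj \<Delta>])
    have "subgroup (\<psi> ` \<Delta>) hw" by (rule \<psi>.subgroup_img_is_subgroup[OF \<Delta>])
    then show ?thesis
      using n_def[symmetric]
    proof (cases rule: hw_subgroup_cases)
      case 1
      then show ?thesis using iso_trans[OF iso hw_subgroup_isos(1)[OF n]] by (simp add: pi1_G1_eq)
    next
      case 2
      show ?thesis
        using iso_trans[OF iso_trans[OF iso hw_subgroup_isos(2)[OF n 2]] group.iso_sym[OF G2 pi1_G2_iso]]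
        by simp
    next
      case 3
      show ?thesis
        using iso_trans[OF iso_trans[OF iso hw_subgroup_isos(3)[OF n 3]] group.iso_sym[OF G6 pi1_G6_iso]]
        by simp
    qed
  qed
  with counts show ?thesis by blast
qed

end
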